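(* Let $G$ be a finite simple chordal graph with $n$ vertices and $c$ connected components, and let $k\ge 1$. If $c\ge k$, then $\Delta_k^t(G)$ is homotopy equivalent to a wedge of $\binom{c-1}{k-1}$ spheres of dimension $n-k-1$. If $c<k$, then $\Delta_k^t(G)$ is contractible if $G$ has an independent set of size $k$, and otherwise it is the void complex.
   Context: A graph is chordal if it has no induced cycle with more than 3 vertices. For $k\ge 1$, the total $k$-cut complex $\Delta_k^t(G)$ is the simplicial complex on $V(G)$ whose facets are the complements $V(G)\setminus S$ of independent sets $S$ of size $k$ in $G$; it is the void complex (no faces, not even $\emptyset$) if there are none. *)

theory Defs
  imports "HOL-Analysis.Analysis"
begin

definition finite_simple_graph :: "'a set \<Rightarrow> ('a \<times> 'a) set \<Rightarrow> bool" where
  "finite_simple_graph V E \<longleftrightarrow> finite V \<and> E \<subseteq> V \<times> V \<and> sym E \<and> irrefl E"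

text \<open>For a symmetric edge relation on V, the class of a vertex under the reflexive transitive
  closure is the vertex set of its connected component.\<close>

definition connected_components :: "'a set \<Rightarrow> ('a \<times> 'a) set \<Rightarrow> 'a set set" where
  "connected_components V E = V // E\<^sup>*"

definition independent_set :: "'a set \<Rightarrow> ('a \<times> 'a) set \<Rightarrow> 'a set \<Rightarrow> bool" where
  "independent_set V E S \<longleftrightarrow> S \<subseteq> V \<and> (\<forall>u\<in>S. \<forall>v\<in>S. (u, v) \<notin> E)"

text \<open>An induced cycle is given by listing its vertices in cyclic order: two listed vertices are
  adjacent exactly when they are cyclically consecutive.\<close>

definition induced_cycle :: "'a set \<Rightarrow> ('a \<times> 'a) set \<Rightarrow> 'a list \<Rightarrow> bool" where
  "induced_cycle V E p \<longleftrightarrow>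
     length p \<ge> 3 \<and> distinct p \<and> set p \<subseteq> V \<and>
     (\<forall>i<length p. \<forall>j<length p.
        (p ! i, p ! j) \<in> E \<longleftrightarrow> j = Suc i mod length p \<or> i = Suc j mod length p)"

definition chordal :: "'a set \<Rightarrow> ('a \<times> 'a) set \<Rightarrow> bool" where
  "chordal V E \<longleftrightarrow> (\<nexists>p. induced_cycle V E p \<and> length p > 3)"

text \<open>A simplicial complex is represented by its set of faces, so the void complex is the empty set,
  as opposed to the complex whose only face is the empty set.\<close>

definition total_cut_complex :: "'a set \<Rightarrow> ('a \<times> 'a) set \<Rightarrow> nat \<Rightarrow> 'a set set" where
  "total_cut_complex V E k = {F. \<exists>S. independent_set V E S \<and> card S = k \<and> F \<subseteq> V - S}"

text \<open>Points are given by barycentric coordinates. The product topology is the usual topology of the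
  realization for finite complexes, the only ones considered here.\<close>

definition geometric_realization :: "'a set set \<Rightarrow> ('a \<Rightarrow> real) topology" where
  "geometric_realization K =
     subtopology (powertop_real UNIV)
       {x. (\<forall>v. 0 \<le> x v) \<and> {v. x v \<noteq> 0} \<in> K \<and> (\<Sum>v | x v \<noteq> 0. x v) = 1}"

text \<open>In the library the empty space satisfies \<^const>\<open>contractible_space\<close>, hence the first conjunct.\<close>

definition contractible_complex :: "'a set set \<Rightarrow> bool" where
  "contractible_complex K \<longleftrightarrow>
     topspace (geometric_realization K) \<noteq> {} \<and> contractible_space (geometric_realization K)"

definition quotient_topology :: "'a topology \<Rightarrow> ('a \<Rightarrow> 'b) \<Rightarrow> 'b topology" where
  "quotient_topology X f =
     topology (\<lambda>U. U \<subseteq> f ` topspace X \<and> openin X {x \<in> topspace X. f x \<in> U})"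

lemma istopology_quotient:
  "istopology (\<lambda>U. U \<subseteq> f ` topspace X \<and> openin X {x \<in> topspace X. f x \<in> U})"
proof -
  have 1: "{x \<in> topspace X. f x \<in> S \<inter> T} =
      {x \<in> topspace X. f x \<in> S} \<inter> {x \<in> topspace X. f x \<in> T}" for S T
    by auto
  have 2: "{x \<in> topspace X. f x \<in> \<Union>\<K>} = (\<Union>K\<in>\<K>. {x \<in> topspace X. f x \<in> K})" for \<K>
    by auto
  show ?thesis
    unfolding istopology_def 1 2
    by (intro conjI allI impI openin_Int openin_clauses(3) le_infI1 Sup_least; (elim conjE)?) auto
qed

lemma openin_quotient_topology:
  "openin (quotient_topology X f) U \<longleftrightarrow>
     U \<subseteq> f ` topspace X \<and> openin X {x \<in> topspace X. f x \<in> U}"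
  by (simp add: quotient_topology_def istopology_quotient)

lemma topspace_quotient_topology: "topspace (quotient_topology X f) = f ` topspace X"
proof
  show "topspace (quotient_topology X f) \<subseteq> f ` topspace X"
    using openin_topspace[of "quotient_topology X f"] by (simp only: openin_quotient_topology)
  have "{x \<in> topspace X. f x \<in> f ` topspace X} = topspace X"
    by blast
  then have "openin (quotient_topology X f) (f ` topspace X)"
    by (simp add: openin_quotient_topology)
  then show "f ` topspace X \<subseteq> topspace (quotient_topology X f)"
    by (rule openin_subset)
qed

lemma quotient_map_quotient_topology: "quotient_map X (quotient_topology X f) f"
  by (simp add: quotient_map_def topspace_quotient_topology openin_quotient_topology)

text \<open>Wedge of a nonempty family of pointed spaces: the disjoint union with all base points
  identified to \<^const>\<open>None\<close>.\<close>

definition wedge ::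
  "('i \<Rightarrow> 'b topology) \<Rightarrow> ('i \<Rightarrow> 'b) \<Rightarrow> 'i set \<Rightarrow> ('i \<times> 'b) option topology" where
  "wedge X b I =
     quotient_topology (sum_topology X I) (\<lambda>(i, x). if x = b i then None else Some (i, x))"

text \<open>The sphere of dimension -1 is the empty space, the realization of the complex whose only face
  is the empty set.\<close>

definition unit_sphere :: "int \<Rightarrow> (nat \<Rightarrow> real) topology" where
  "unit_sphere d = (if d < 0 then discrete_topology {} else nsphere (nat d))"

text \<open>The base point is the first unit vector. A single sphere of dimension -1 is also covered: its
  wedge is empty.\<close>

definition wedge_of_spheres :: "nat \<Rightarrow> int \<Rightarrow> (nat \<times> (nat \<Rightarrow> real)) option topology" where
  "wedge_of_spheres m d =
     wedge (\<lambda>_. unit_sphere d) (\<lambda>_ j. if j = 0 then 1 else 0) {..<m}"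

end

theory Submission
  imports Defs
begin

text \<open>Let v be a simplicial vertex of the chordal graph G, which exists by Dirac's theorem, and
  \<open>k \<ge> 1\<close>. The link of v in the total k-cut complex of G is the total k-cut complex of \<open>G - v\<close>. If v
  has a neighbour u, the faces avoiding v form a cone with apex u, because u may be exchanged for v in
  an independent set; if v is isolated, they form the total \<open>(k-1)\<close>-cut complex of \<open>G - v\<close>. Induction on
  the number of vertices therefore yields a set T of \<open>c - 1\<close> choose \<open>k - 1\<close> facets of dimension
  \<open>n - k - 1\<close> such that the complex without T is void or collapsible. Contracting this remainder turns
  every facet in T into a sphere.\<close>

section \<open>Geometric realizations\<close>

text \<open>A uniform induction forces several choices. An isolated vertex lowers k, so k = 0
  occurs, where the complex is a full simplex. The empty face takes part in collapses, so that the
  remainder is collapsible even when it is void; for a nonvoid complex this happens only if n = k,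
  where the sphere has dimension -1. Collapses of the link lift to the faces containing v, after
  which the deletion collapses on its own; hence the critical facets of link and deletion add up, by
  Pascal's rule for isolated v, while a cone contributes none.

  All members of T have n - k vertices, the largest size of a face. So their proper faces lie in the
  remainder, and their interiors are disjoint cells attached to it.

  The topology is done by explicit formulas in barycentric coordinates. The minimum of the
  coordinates over a face measures the distance from its boundary, both in the retraction of an
  elementary collapse and in the collar on which a contraction of the remainder is extended to the
  whole complex.\<close>

definition complex_on :: "'a set \<Rightarrow> 'a set set \<Rightarrow> bool" where
  "complex_on V K \<longleftrightarrow> finite V \<and> K \<subseteq> Pow V \<and> (\<forall>F\<in>K. \<forall>F'. F' \<subseteq> F \<longrightarrow> F' \<in> K)"

lemma complex_on_finite: "complex_on V K \<Longrightarrow> finite K"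
  unfolding complex_on_def by (meson finite_Pow_iff finite_subset)

text \<open>Summing over the fixed set \<open>V\<close> instead of the support makes the condition
  on the total mass linear in \<open>x\<close>.\<close>

lemma topspace_geometric_realization:
  assumes "complex_on V K"
  shows "x \<in> topspace (geometric_realization K) \<longleftrightarrow>
    (\<forall>v. 0 \<le> x v) \<and> {v. x v \<noteq> 0} \<in> K \<and> sum x V = 1"
proof -
  have "(\<Sum>v | x v \<noteq> 0. x v) = sum x V" if "{v. x v \<noteq> 0} \<in> K"
    by (rule sum.mono_neutral_left) (use that assms in \<open>auto simp: complex_on_def\<close>)
  then show ?thesis
    by (auto simp: geometric_realization_def)
qed

lemma geometric_realizationI:
  assumes "complex_on V K" "\<And>v. 0 \<le> x v" "F \<in> K" "\<And>v. v \<notin> F \<Longrightarrow> x v = 0" "sum x V = 1"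
  shows "x \<in> topspace (geometric_realization K)"
proof -
  have "{v. x v \<noteq> 0} \<subseteq> F"
    using assms(4) by blast
  then have "{v. x v \<noteq> 0} \<in> K"
    using assms(1,3) by (auto simp: complex_on_def)
  then show ?thesis
    using assms by (simp add: topspace_geometric_realization)
qed

lemma continuous_map_into_realization:
  "continuous_map X (geometric_realization K) f \<longleftrightarrow>
    (\<forall>v. continuous_map X euclideanreal (\<lambda>x. f x v)) \<and>
    (\<forall>x\<in>topspace X. f x \<in> topspace (geometric_realization K))"
  by (auto simp: geometric_realization_def continuous_map_in_subtopology
      continuous_map_componentwise_UNIV)

lemma continuous_map_realization_coordinate:
  "continuous_map X (geometric_realization K) f \<Longrightarrow> continuous_map X euclideanreal (\<lambda>x. f x v)"
  by (simp add: continuous_map_into_realization)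

lemma continuous_map_coordinate:
  "continuous_map (geometric_realization K) euclideanreal (\<lambda>x. x v)"
  using continuous_map_realization_coordinate[OF continuous_map_id] by simp

lemma continuous_map_Min:
  fixes f :: "'b \<Rightarrow> 'i \<Rightarrow> real"
  assumes "finite S" "S \<noteq> {}" "\<And>u. u \<in> S \<Longrightarrow> continuous_map X euclideanreal (\<lambda>x. f x u)"
  shows "continuous_map X euclideanreal (\<lambda>x. Min (f x ` S))"
  using assms
proof (induction S rule: finite_ne_induct)
  case (insert u S)
  then have "continuous_map X euclideanreal (\<lambda>x. min (f x u) (Min (f x ` S)))"
    by (intro continuous_map_real_min) auto
  with insert show ?case by simp
qed simp

text \<open>The segment from \<open>f x\<close> to \<open>g x\<close> stays in the simplex spanned
  by the union of the two supports, which is a face; so the straight-line homotopy never leaves the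
  realization.\<close>

lemma contiguous_imp_homotopic:
  fixes f g :: "'b \<Rightarrow> 'a \<Rightarrow> real"
  assumes K: "complex_on V K"
    and f: "continuous_map X (geometric_realization K) f"
    and g: "continuous_map X (geometric_realization K) g"
    and contig: "\<And>x. x \<in> topspace X \<Longrightarrow> {v. f x v \<noteq> 0} \<union> {v. g x v \<noteq> 0} \<in> K"
  shows "homotopic_with (\<lambda>_. True) X (geometric_realization K) f g"
proof -
  define h where "h = (\<lambda>(s::real, x) v. (1 - s) * f x v + s * g x v)"
  have cont: "continuous_map (prod_topology (top_of_set {0..1}) X) euclideanreal (\<lambda>z. h z v)" for v
  proof -
    have "continuous_map (prod_topology (top_of_set {0..1::real}) X) euclideanreal (\<lambda>z. f (snd z) v)"
      "continuous_map (prod_topology (top_of_set {0..1::real}) X) euclideanreal (\<lambda>z. g (snd z) v)"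
      using continuous_map_compose[OF continuous_map_snd[of "top_of_set {0..1::real}"] f]
        continuous_map_compose[OF continuous_map_snd[of "top_of_set {0..1::real}"] g]
      unfolding continuous_map_into_realization o_def by blast+
    moreover have "continuous_map (prod_topology (top_of_set {0..1}) X) euclideanreal (fst :: real \<times> 'b \<Rightarrow> real)"
      by (rule continuous_map_into_fulltopology[OF continuous_map_fst])
    ultimately have "continuous_map (prod_topology (top_of_set {0..1}) X) euclideanreal
        (\<lambda>z. (1 - fst z) * f (snd z) v + fst z * g (snd z) v)"
      by (intro continuous_map_add continuous_map_diff continuous_map_real_mult continuous_map_canonical_const)
    then show ?thesis
      by (simp add: h_def case_prod_unfold)
  qed
  have "h (s, x) \<in> topspace (geometric_realization K)"
    if s: "s \<in> {0..1}" and x: "x \<in> topspace X" for s x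
  proof (rule geometric_realizationI[OF K _ contig[OF x]])
    have fx: "f x \<in> topspace (geometric_realization K)" and gx: "g x \<in> topspace (geometric_realization K)"
      using f g x by (auto simp: continuous_map_into_realization)
    show "0 \<le> h (s, x) v" for v
      using fx gx s by (simp add: h_def topspace_geometric_realization[OF K])
    show "h (s, x) v = 0" if "v \<notin> {v. f x v \<noteq> 0} \<union> {v. g x v \<noteq> 0}" for v
      using that by (simp add: h_def)
    show "sum (h (s, x)) V = 1"
      using fx gx by (simp add: h_def topspace_geometric_realization[OF K] sum.distrib
          flip: sum_distrib_left)
  qed
  with cont have "continuous_map (prod_topology (top_of_set {0..1}) X) (geometric_realization K) h"
    by (auto simp: continuous_map_into_realization)
  then show ?thesis
    unfolding homotopic_with_def by (intro exI[of _ h]) (auto simp: h_def)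
qed

section \<open>Elementary collapses\<close>

text \<open>A remaining face does not contain \<open>\<sigma>\<close>, hence neither do its subsets,
  so none of them is one of the two removed faces.\<close>

lemma complex_on_collapse:
  assumes "complex_on V K" and "\<And>\<rho>. \<rho> \<in> K \<Longrightarrow> \<sigma> \<subseteq> \<rho> \<Longrightarrow> \<rho> = \<sigma> \<or> \<rho> = insert v \<sigma>"
  shows "complex_on V (K - {\<sigma>, insert v \<sigma>})"
  unfolding complex_on_def
proof (intro conjI ballI allI impI)
  fix F F' assume F: "F \<in> K - {\<sigma>, insert v \<sigma>}" "F' \<subseteq> F"
  have "\<not> \<sigma> \<subseteq> F"
    using assms(2) F by blast
  then have "\<not> \<sigma> \<subseteq> F'"
    using F by blast
  moreover have "F' \<in> K"
    using F assms(1) by (auto simp: complex_on_def)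
  ultimately show "F' \<in> K - {\<sigma>, insert v \<sigma>}"
    by blast
qed (use assms(1) in \<open>auto simp: complex_on_def\<close>)

text \<open>In the simplex \<open>insert v \<sigma>\<close> a point is pushed in the direction from
  the barycenter of \<open>\<sigma>\<close> to \<open>v\<close> until a coordinate over
  \<open>\<sigma>\<close> vanishes. Collapsing the empty face would instead turn a point into the
  void complex, whence \<open>\<sigma> \<noteq> {}\<close>.\<close>

lemma elementary_collapse_homotopy_equivalent:
  assumes K: "complex_on V K" and \<sigma>: "\<sigma> \<in> K" "\<sigma> \<noteq> {}" and v: "v \<notin> \<sigma>" "insert v \<sigma> \<in> K"
    and free: "\<And>\<rho>. \<rho> \<in> K \<Longrightarrow> \<sigma> \<subseteq> \<rho> \<Longrightarrow> \<rho> = \<sigma> \<or> \<rho> = insert v \<sigma>"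
  shows "geometric_realization K homotopy_equivalent_space
    geometric_realization (K - {\<sigma>, insert v \<sigma>})"
proof -
  let ?K' = "K - {\<sigma>, insert v \<sigma>}"
  have K': "complex_on V ?K'"
    using K free by (rule complex_on_collapse)
  have \<sigma>V: "insert v \<sigma> \<subseteq> V" and "finite V"
    using K v by (auto simp: complex_on_def)
  then have fin: "finite \<sigma>" "finite V"
    by (auto intro: finite_subset)
  \<comment> \<open>\<open>t x\<close> is how far \<open>x\<close> can be pushed: every coordinate
    over \<open>\<sigma>\<close> drops by \<open>t x\<close>, and the mass
    \<open>card \<sigma> * t x\<close> thus released goes to \<open>v\<close>.\<close>
  define t where "t = (\<lambda>x::'a \<Rightarrow> real. Min (x ` \<sigma>))"
  define r where "r = (\<lambda>x u. if u \<in> \<sigma> then x u - t x else if u = v then x u + card \<sigma> * t x else x u)"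
  have t_le: "t x \<le> x u" if "u \<in> \<sigma>" for x u
    using that fin by (simp add: t_def)
  have t_att: "\<exists>u\<in>\<sigma>. x u = t x" for x
  proof -
    have "t x \<in> x ` \<sigma>"
      unfolding t_def using fin \<sigma> by (intro Min_in) auto
    then show ?thesis by auto
  qed
  have t_nonneg: "t x \<ge> 0" if "x \<in> topspace (geometric_realization K)" for x
    using t_att[of x] that by (metis topspace_geometric_realization[OF K])
  have r_id: "r x = x" if "t x = 0" for x
    using that by (auto simp: r_def)
  have supp: "{u. x u \<noteq> 0} = \<sigma> \<or> {u. x u \<noteq> 0} = insert v \<sigma>"
    if "x \<in> topspace (geometric_realization K)" "t x \<noteq> 0" for x
  proof (rule free)
    show "\<sigma> \<subseteq> {u. x u \<noteq> 0}"
      using t_le[of _ x] t_nonneg[OF that(1)] that(2) by force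
  qed (use that(1) in \<open>simp add: topspace_geometric_realization[OF K]\<close>)
  have sum_r: "sum (r x) V = sum x V" for x
  proof -
    have "sum (r x) V = (\<Sum>u\<in>V. x u - (if u \<in> \<sigma> then t x else 0) + (if u = v then card \<sigma> * t x else 0))"
      by (rule sum.cong) (use v in \<open>auto simp: r_def\<close>)
    also have "\<dots> = sum x V - (\<Sum>u\<in>V. if u \<in> \<sigma> then t x else 0) + card \<sigma> * t x"
      using fin \<sigma>V by (simp add: sum.distrib sum_subtractf)
    also have "(\<Sum>u\<in>V. if u \<in> \<sigma> then t x else 0) = (\<Sum>u\<in>\<sigma>. t x)"
      using \<sigma>V fin by (subst sum.inter_restrict[symmetric]) (auto simp: Int_absorb1)
    finally show ?thesis by simp
  qed
  have t0: "t x = 0" if "x \<in> topspace (geometric_realization ?K')" for x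
  proof (rule ccontr)
    assume "t x \<noteq> 0"
    moreover have "x \<in> topspace (geometric_realization K)"
      using that by (simp add: topspace_geometric_realization[OF K] topspace_geometric_realization[OF K'])
    ultimately have "{u. x u \<noteq> 0} = \<sigma> \<or> {u. x u \<noteq> 0} = insert v \<sigma>"
      by (rule supp[rotated])
    then show False
      using that by (auto simp: topspace_geometric_realization[OF K'])
  qed
  have r_in: "r x \<in> topspace (geometric_realization ?K')"
    if x: "x \<in> topspace (geometric_realization K)" for x
  proof (cases "t x = 0")
    case True
    have "\<not> \<sigma> \<subseteq> {u. x u \<noteq> 0}"
      using t_att[of x] True by auto
    then show ?thesis
      using x by (auto simp: r_id[OF True] topspace_geometric_realization[OF K] topspace_geometric_realization[OF K'])
  next
    case False
    \<comment> \<open>The vertex attaining the minimum drops out of the support, so the image lies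
      in a face that does not contain \<open>\<sigma>\<close>.\<close>
    obtain u where u: "u \<in> \<sigma>" "x u = t x"
      using t_att by blast
    have x_out: "x w = 0" if "w \<notin> insert v \<sigma>" for w
      using supp[OF x False] that by blast
    show ?thesis
    proof (rule geometric_realizationI[OF K'])
      show "0 \<le> r x w" for w
        using x t_le[of w x] t_nonneg[OF x] by (auto simp: r_def topspace_geometric_realization[OF K])
      show "insert v \<sigma> - {u} \<in> ?K'"
        using K v u by (auto simp: complex_on_def)
      show "r x w = 0" if "w \<notin> insert v \<sigma> - {u}" for w
        using that u x_out[of w] by (auto simp: r_def)
      show "sum (r x) V = 1"
        using x by (simp add: sum_r topspace_geometric_realization[OF K])
    qed
  qed
  have cont_t: "continuous_map (geometric_realization K) euclideanreal t"
    unfolding t_def by (intro continuous_map_Min fin \<sigma> continuous_map_coordinate)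
  have cont_r: "continuous_map (geometric_realization K) euclideanreal (\<lambda>x. r x w)" for w
    by (cases "w \<in> \<sigma>"; cases "w = v"; simp add: r_def; intro continuous_intros continuous_map_coordinate cont_t)
  have r: "continuous_map (geometric_realization K) (geometric_realization ?K') r"
    using cont_r r_in by (simp add: continuous_map_into_realization)
  have i: "continuous_map (geometric_realization ?K') (geometric_realization K) id"
    by (auto simp: continuous_map_into_realization continuous_map_coordinate
        topspace_geometric_realization[OF K] topspace_geometric_realization[OF K'])
  \<comment> \<open>\<open>x\<close> and \<open>r x\<close> always share a face: the support of
    \<open>x\<close> if nothing moves, and \<open>insert v \<sigma>\<close> otherwise.\<close>
  have "homotopic_with (\<lambda>_. True) (geometric_realization K) (geometric_realization K) (id \<circ> r) id"
  proof (rule contiguous_imp_homotopic[OF K])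
    fix x assume x: "x \<in> topspace (geometric_realization K)"
    show "{u. (id \<circ> r) x u \<noteq> 0} \<union> {u. id x u \<noteq> 0} \<in> K"
    proof (cases "t x = 0")
      case True
      then show ?thesis using x by (simp add: r_id topspace_geometric_realization[OF K])
    next
      case False
      have "{u. (id \<circ> r) x u \<noteq> 0} \<union> {u. id x u \<noteq> 0} \<subseteq> insert v \<sigma>"
        using supp[OF x False] by (auto simp: r_def split: if_splits)
      then show ?thesis
        using K v by (auto simp: complex_on_def)
    qed
  qed (use continuous_map_compose[OF r i] in auto)
  moreover have "homotopic_with (\<lambda>_. True) (geometric_realization ?K') (geometric_realization ?K') (r \<circ> id) id"
    by (rule homotopic_with_equal) (use continuous_map_compose[OF i r] r_id t0 in auto)
  ultimately show ?thesis
    unfolding homotopy_equivalent_space_def using r i by blast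
qed

section \<open>Collapsible complexes\<close>

text \<open>The empty face may be collapsed too, so that a complex collapsing to a point is reduced further
  to the void complex. This makes the void complex collapsible.\<close>

inductive collapsible :: "'a set set \<Rightarrow> bool" where
  void: "collapsible {}"
| collapse: "\<lbrakk>\<sigma> \<in> K; v \<notin> \<sigma>; insert v \<sigma> \<in> K;
    \<And>\<rho>. \<rho> \<in> K \<Longrightarrow> \<sigma> \<subseteq> \<rho> \<Longrightarrow> \<rho> = \<sigma> \<or> \<rho> = insert v \<sigma>;
    collapsible (K - {\<sigma>, insert v \<sigma>})\<rbrakk> \<Longrightarrow> collapsible K"

text \<open>The empty face is free only in a complex with a single vertex, so the step that
  collapses it starts from a point. Every other step is a homotopy equivalence that leaves the empty
  face in place.\<close>

lemma collapsible_imp_contractible: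
  assumes "collapsible K" "complex_on V K" "K \<noteq> {}"
  shows "contractible_complex K"
  using assms
proof (induction rule: collapsible.induct)
  case (collapse \<sigma> K v)
  let ?K' = "K - {\<sigma>, insert v \<sigma>}"
  have K': "complex_on V ?K'"
    using collapse.prems(1) collapse.hyps(4) by (rule complex_on_collapse)
  show ?case
  proof (cases "\<sigma> = {}")
    case True
    then have K: "K = {{}, {v}}"
      using collapse by auto
    have vV: "v \<in> V" "finite V"
      using collapse.prems by (auto simp: K complex_on_def)
    have "topspace (geometric_realization K) = {\<lambda>u. if u = v then 1 else 0}"
    proof (intro equalityI subsetI)
      fix x assume x: "x \<in> topspace (geometric_realization K)"
      then have s: "sum x V = 1" "{u. x u \<noteq> 0} = {} \<or> {u. x u \<noteq> 0} = {v}"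
        unfolding topspace_geometric_realization[OF collapse.prems(1)] using K by blast+
      then have out: "u \<noteq> v \<Longrightarrow> x u = 0" for u
        by auto
      have "sum x V = sum x {v}"
        by (rule sum.mono_neutral_right) (use vV out in auto)
      with s out show "x \<in> {\<lambda>u. if u = v then 1 else 0}"
        by auto
    next
      fix x :: "'a \<Rightarrow> real" assume "x \<in> {\<lambda>u. if u = v then 1 else 0}"
      then show "x \<in> topspace (geometric_realization K)"
        by (intro geometric_realizationI[OF collapse.prems(1), where F = "{v}"]) (use vV K in auto)
    qed
    then show ?thesis
      by (simp add: contractible_complex_def contractible_space_subset_singleton
          flip: subset_singleton_iff)
  next
    case False
    have "{} \<in> ?K'"
      using collapse.prems collapse.hyps(1) False by (auto simp: complex_on_def)
    then have "contractible_complex ?K'"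
      using collapse.IH K' by auto
    moreover have "topspace (geometric_realization ?K') \<subseteq> topspace (geometric_realization K)"
      by (auto simp: topspace_geometric_realization[OF collapse.prems(1)] topspace_geometric_realization[OF K'])
    moreover have "geometric_realization K homotopy_equivalent_space geometric_realization ?K'"
      by (rule elementary_collapse_homotopy_equivalent[OF collapse.prems(1)]) (use collapse.hyps False in auto)
    ultimately show ?thesis
      by (auto simp: contractible_complex_def dest: homotopy_equivalent_space_contractibility)
  qed
qed simp

text \<open>A collapse in \<open>L\<close> lifts by inserting \<open>v\<close>: a coface of
  \<open>insert v \<sigma>\<close> contains \<open>v\<close> and hence comes from \<open>L\<close>,
  so \<open>D\<close> cannot obstruct freeness. \<open>D\<close> is collapsed last. In the
  application, \<open>L\<close> and \<open>D\<close> are the link and the deletion of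
  \<open>v\<close> without their critical facets.\<close>

lemma collapsible_attach_cone:
  assumes "collapsible L" "collapsible D" "\<And>F. F \<in> D \<union> L \<Longrightarrow> v \<notin> F"
  shows "collapsible (D \<union> insert v ` L)"
  using assms
proof (induction rule: collapsible.induct)
  case void
  then show ?case by simp
next
  case (collapse \<sigma> L w)
  let ?K = "D \<union> insert v ` L"
  have v: "v \<notin> \<sigma>" "v \<noteq> w"
    using collapse.prems(2)[of \<sigma>] collapse.prems(2)[of "insert w \<sigma>"] collapse.hyps by auto
  have inj: "inj_on (insert v) L"
    using collapse.prems(2) by (intro inj_onI) (metis UnI2 insert_ident)
  show ?case
  proof (rule collapsible.collapse)
    show "insert v \<sigma> \<in> ?K" "w \<notin> insert v \<sigma>"
      using collapse.hyps v by auto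
    show "insert w (insert v \<sigma>) \<in> ?K"
      using collapse.hyps by (simp add: insert_commute)
    show "\<rho> = insert v \<sigma> \<or> \<rho> = insert w (insert v \<sigma>)" if \<rho>: "\<rho> \<in> ?K" "insert v \<sigma> \<subseteq> \<rho>" for \<rho>
    proof -
      obtain \<rho>' where \<rho>': "\<rho>' \<in> L" "\<rho> = insert v \<rho>'"
        using \<rho> collapse.prems(2)[of \<rho>] by blast
      with \<rho> v have "\<sigma> \<subseteq> \<rho>'" by auto
      with \<rho>' collapse.hyps(4) show ?thesis by (auto simp: insert_commute)
    qed
    have "insert v ` L - {insert v \<sigma>, insert v (insert w \<sigma>)} = insert v ` (L - {\<sigma>, insert w \<sigma>})"
      using inj_on_image_set_diff[OF inj, of L "{\<sigma>, insert w \<sigma>}"] collapse.hyps by auto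
    moreover have "insert v \<sigma> \<notin> D" "insert v (insert w \<sigma>) \<notin> D"
      using collapse.prems(2) by auto
    then have "?K - {insert v \<sigma>, insert v (insert w \<sigma>)}
        = D \<union> (insert v ` L - {insert v \<sigma>, insert v (insert w \<sigma>)})"
      by (simp add: Un_Diff)
    ultimately have "?K - {insert v \<sigma>, insert w (insert v \<sigma>)} = D \<union> insert v ` (L - {\<sigma>, insert w \<sigma>})"
      by (simp only: insert_commute[of w v])
    moreover have "collapsible (D \<union> insert v ` (L - {\<sigma>, insert w \<sigma>}))"
      using collapse.prems by (intro collapse.IH) blast+
    ultimately show "collapsible (?K - {insert v \<sigma>, insert w (insert v \<sigma>)})"
      by (simp only:)
  qed
qed

text \<open>Faces are paired by adding \<open>u\<close>, and a pair with \<open>\<sigma>\<close> of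
  largest size among the faces without \<open>u\<close> is removed first: a larger coface would
  yield a larger face without \<open>u\<close>. Closure under adding and removing \<open>u\<close>
  survives the removal of a pair.\<close>

lemma collapsible_cone:
  assumes "finite K" "\<And>F. F \<in> K \<Longrightarrow> finite F" "\<And>F. F \<in> K \<Longrightarrow> insert u F \<in> K \<and> F - {u} \<in> K"
  shows "collapsible K"
  using assms
proof (induction "card K" arbitrary: K rule: less_induct)
  case less
  show ?case
  proof (cases "K = {}")
    case False
    let ?A = "{F \<in> K. u \<notin> F}"
    have "?A \<noteq> {}" "finite ?A"
      using False less.prems(1,3) by auto
    then obtain \<sigma> where \<sigma>: "\<sigma> \<in> K" "u \<notin> \<sigma>" and max: "\<And>F. F \<in> ?A \<Longrightarrow> card F \<le> card \<sigma>"
      using finite_has_maximal2[of "card ` ?A"]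
      by (smt (verit) Max_ge Max_in finite_imageI image_iff image_is_empty imageI mem_Collect_eq)
    have \<sigma>u: "insert u \<sigma> \<in> K"
      using less.prems(3) \<sigma> by blast
    show ?thesis
    proof (rule collapsible.collapse[OF \<sigma> \<sigma>u])
      fix \<rho> assume \<rho>: "\<rho> \<in> K" "\<sigma> \<subseteq> \<rho>"
      have "card (\<rho> - {u}) \<le> card \<sigma>"
        using \<rho> less.prems(3) by (intro max) auto
      moreover have "\<sigma> \<subseteq> \<rho> - {u}" "finite (\<rho> - {u})"
        using \<rho> \<sigma> less.prems(2) by auto
      ultimately have "\<sigma> = \<rho> - {u}"
        by (simp add: card_seteq)
      then show "\<rho> = \<sigma> \<or> \<rho> = insert u \<sigma>"
        by blast
    next
      show "collapsible (K - {\<sigma>, insert u \<sigma>})"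
      proof (rule less.hyps)
        show "card (K - {\<sigma>, insert u \<sigma>}) < card K"
          using \<sigma> less.prems(1) by (intro psubset_card_mono) auto
        fix F assume F: "F \<in> K - {\<sigma>, insert u \<sigma>}"
        then have ne: "F - {u} \<noteq> \<sigma>"
          by (cases "u \<in> F") (auto simp: insert_absorb)
        have "insert u F \<noteq> insert u \<sigma>"
        proof
          assume "insert u F = insert u \<sigma>"
          then have "insert u F - {u} = insert u \<sigma> - {u}" by (simp only:)
          with ne \<sigma>(2) show False by simp
        qed
        with ne show "insert u F \<in> K - {\<sigma>, insert u \<sigma>} \<and> F - {u} \<in> K - {\<sigma>, insert u \<sigma>}"
          using less.prems(3)[of F] F \<sigma>(2) by blast
      qed (use less.prems in auto)
    qed
  qed (simp add: collapsible.void)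
qed

section \<open>Contracting all but some facets\<close>

text \<open>The end \<open>H (1, _)\<close> is constant on the fibres of \<open>q\<close> and
  descends to a homotopy inverse of \<open>q\<close>. \<open>H\<close> itself is the homotopy on
  \<open>X\<close>, and the one on \<open>W\<close> is obtained by letting
  \<open>q \<circ> H\<close> descend.\<close>

lemma quotient_map_homotopy_equivalent:
  assumes q: "quotient_map X W q"
    and H: "continuous_map (prod_topology (top_of_set {0..1::real}) X) X H"
    and H0: "\<And>x. x \<in> topspace X \<Longrightarrow> H (0, x) = x"
    and compat: "\<And>s x y. \<lbrakk>s \<in> {0..1}; x \<in> topspace X; y \<in> topspace X; q x = q y\<rbrakk> \<Longrightarrow> q (H (s, x)) = q (H (s, y))"
    and H1: "\<And>x y. \<lbrakk>x \<in> topspace X; y \<in> topspace X; q x = q y\<rbrakk> \<Longrightarrow> H (1, x) = H (1, y)"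
  shows "X homotopy_equivalent_space W"
proof -
  \<comment> \<open>An arbitrary, possibly discontinuous section of \<open>q\<close>; continuity of
    what is built from it comes from the quotient property.\<close>
  define j where "j = inv_into (topspace X) q"
  have surj: "q ` topspace X = topspace W"
    using q by (simp add: quotient_map_def)
  have j: "j (q x) \<in> topspace X" "q (j (q x)) = q x" if "x \<in> topspace X" for x
    using that by (auto simp: j_def inv_into_into f_inv_into_f)
  define g where "g = (\<lambda>w. H (1, j w))"
  have gq: "g (q x) = H (1, x)" if "x \<in> topspace X" for x
    unfolding g_def using that j by (intro H1) auto
  have contq: "continuous_map X W q"
    by (rule quotient_imp_continuous_map[OF q])
  have "continuous_map X X (\<lambda>x. H (1, x))"
    using continuous_map_compose[OF _ H, of X "\<lambda>x. (1, x)"]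
    by (simp add: o_def continuous_map_pairwise continuous_map_in_subtopology)
  then have contgq: "continuous_map X X (g \<circ> q)"
    by (rule continuous_map_eq) (simp add: gq)
  then have contg: "continuous_map W X g"
    by (rule continuous_compose_quotient_map[OF q])
  have "homotopic_with (\<lambda>_. True) X X id (g \<circ> q)"
    by (subst homotopic_with, simp, rule exI[of _ H]) (auto simp: H H0 gq)
  moreover have "homotopic_with (\<lambda>_. True) W W id (q \<circ> g)"
  proof -
    let ?I = "top_of_set {0..1::real}"
    define h where "h = (\<lambda>(s, w). q (H (s, j w)))"
    \<comment> \<open>The unit interval is locally compact Hausdorff, so its product with
      \<open>q\<close> is again a quotient map and continuity of \<open>h\<close> can be tested
      before passing to the quotient.\<close>
    have "quotient_map (prod_topology ?I X) (prod_topology ?I W) (\<lambda>(s, x). (s, q x))"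
      by (rule quotient_map_prod_right[OF _ _ q])
        (auto simp: compact_imp_locally_compact_space compact_space_subtopology
          Hausdorff_space_subtopology)
    moreover have "continuous_map (prod_topology ?I X) W (h \<circ> (\<lambda>(s, x). (s, q x)))"
    proof (rule continuous_map_eq[OF continuous_map_compose[OF H contq]])
      fix z assume "z \<in> topspace (prod_topology ?I X)"
      then obtain s x where "z = (s, x)" "s \<in> {0..1}" "x \<in> topspace X"
        by auto
      then show "(q \<circ> H) z = (h \<circ> (\<lambda>(s, x). (s, q x))) z"
        using compat[of s x "j (q x)"] j[of x] by (simp add: h_def)
    qed
    ultimately have "continuous_map (prod_topology ?I W) W h"
      by (rule continuous_compose_quotient_map)
    moreover have "h (0, w) = w" if "w \<in> topspace W" for w
      using that j H0 unfolding surj[symmetric] h_def by auto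
    moreover have "h (1, w) = q (g w)" for w
      by (simp add: h_def g_def)
    ultimately show ?thesis
      by (subst homotopic_with, simp, intro exI[of _ h]) auto
  qed
  ultimately show ?thesis
    unfolding homotopy_equivalent_space_def
    by (intro exI[of _ q] exI[of _ g] conjI contq contg) (auto intro: homotopic_with_symD)
qed

section \<open>Closed simplices mapped to spheres\<close>

lemma complex_on_Pow: "finite F \<Longrightarrow> complex_on F (Pow F)"
  by (auto simp: complex_on_def)

lemma topspace_geometric_simplex:
  assumes "finite F"
  shows "x \<in> topspace (geometric_realization (Pow F)) \<longleftrightarrow>
    (\<forall>v. 0 \<le> x v) \<and> (\<forall>v. v \<notin> F \<longrightarrow> x v = 0) \<and> sum x F = 1"
  unfolding topspace_geometric_realization[OF complex_on_Pow[OF assms]] Pow_iff by blast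

lemma Hausdorff_geometric_realization: "Hausdorff_space (geometric_realization K)"
  unfolding geometric_realization_def
  by (intro Hausdorff_space_subtopology) (simp add: Hausdorff_space_product_topology)

text \<open>The simplex is a closed slice of a box that is compact by Tychonoff's theorem.
  Compactness later makes the maps from facets to spheres closed.\<close>

lemma compact_geometric_simplex:
  assumes "finite F"
  shows "compact_space (geometric_realization (Pow F))"
proof -
  let ?P = "powertop_real UNIV :: ('a \<Rightarrow> real) topology"
  let ?B = "PiE UNIV (\<lambda>v. if v \<in> F then {0..1::real} else {0})"
  have "continuous_map ?P euclideanreal (\<lambda>x. sum x F)"
    by (intro continuous_map_sum assms) (rule continuous_map_product_projection, simp)
  then have "closedin ?P {x \<in> topspace ?P. sum x F \<in> {1}}"
    by (rule closedin_continuous_map_preimage) simp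
  moreover have "compactin ?P ?B"
    unfolding compactin_PiE by simp
  ultimately have "compactin ?P ({x \<in> topspace ?P. sum x F \<in> {1}} \<inter> ?B)"
    by (rule closed_Int_compactin)
  moreover have "{x \<in> topspace ?P. sum x F \<in> {1}} \<inter> ?B = topspace (geometric_realization (Pow F))"
    (is "?l = ?r")
  proof (intro equalityI subsetI)
    fix x assume "x \<in> ?l"
    then have x: "sum x F = 1" "\<And>v. x v \<in> (if v \<in> F then {0..1} else {0})"
      by (simp_all only: Int_iff mem_Collect_eq singleton_iff PiE_iff UNIV_I)
    have "0 \<le> x v" "v \<notin> F \<Longrightarrow> x v = 0" for v
      using x(2)[of v] by (auto split: if_splits)
    then show "x \<in> ?r"
      using x(1) by (simp add: topspace_geometric_simplex[OF assms])
  next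
    fix x assume "x \<in> ?r"
    then have x: "\<And>v. 0 \<le> x v" "\<And>v. v \<notin> F \<Longrightarrow> x v = 0" "sum x F = 1"
      by (auto simp: topspace_geometric_simplex[OF assms])
    have "x v \<le> 1" if "v \<in> F" for v
      using member_le_sum[of v F x] that assms x by simp
    with x show "x \<in> ?l" by auto
  qed
  ultimately have "compactin ?P (topspace (geometric_realization (Pow F)))"
    by simp
  then show ?thesis
    unfolding geometric_realization_def by (simp add: compact_space_subtopology)
qed

text \<open>Up to a rescaling by the barycentric coordinates' minimum, which turns the simplex boundary into
  the points at infinity of its affine hull, the map is inverse stereographic projection. Writing it in
  homogeneous form avoids all case distinctions.\<close>

lemma simplex_to_sphere:
  fixes \<sigma> :: "'a set" and d :: nat
  defines "b \<equiv> (\<lambda>j::nat. if j = 0 then 1 else 0 :: real)"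
  assumes "finite \<sigma>" "card \<sigma> = Suc d"
  obtains \<phi> where "continuous_map (geometric_realization (Pow \<sigma>)) (nsphere d) \<phi>"
    and "\<And>x. x \<in> topspace (geometric_realization (Pow \<sigma>)) \<Longrightarrow> \<phi> x = b \<longleftrightarrow> {v. x v \<noteq> 0} \<noteq> \<sigma>"
    and "\<And>x y. \<lbrakk>x \<in> topspace (geometric_realization (Pow \<sigma>)); y \<in> topspace (geometric_realization (Pow \<sigma>));
      \<phi> x = \<phi> y; \<phi> x \<noteq> b\<rbrakk> \<Longrightarrow> x = y"
    and "\<And>p. \<lbrakk>p \<in> topspace (nsphere d); p \<noteq> b\<rbrakk> \<Longrightarrow> \<exists>x\<in>topspace (geometric_realization (Pow \<sigma>)). \<phi> x = p"
proof -
  let ?X = "geometric_realization (Pow \<sigma>)"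
  have \<sigma>ne: "\<sigma> \<noteq> {}" using assms by auto
  obtain e where e: "bij_betw e {..d} \<sigma>"
    using ex_bij_betw_nat_finite[OF assms(2)] assms(3) by (auto simp: atLeast0LessThan lessThan_Suc_atMost)
  have e\<sigma>: "e i \<in> \<sigma>" if "i \<le> d" for i
    using e that by (auto simp: bij_betw_def)
  have sum_e: "sum f \<sigma> = (\<Sum>i\<le>d. f (e i))" for f :: "'a \<Rightarrow> real"
    using sum.reindex_bij_betw[OF e, of f] by simp
  have split0: "(\<Sum>i\<le>d. f i) = f 0 + (\<Sum>i=1..d. f i)" for f :: "nat \<Rightarrow> real"
  proof -
    have "{..d} = insert 0 {1..d}" by auto
    then show ?thesis by simp
  qed
  \<comment> \<open>The coordinate of the barycenter: \<open>\<tau>\<close> runs from 0 on the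
    boundary to 1 at the barycenter, and \<open>\<zeta>\<close> is centred there.\<close>
  define c where "c = 1 / real (Suc d)"
  have c: "c > 0" "real (Suc d) * c = 1" by (auto simp: c_def)
  define \<tau> where "\<tau> = (\<lambda>x::'a \<Rightarrow> real. real (Suc d) * Min (x ` \<sigma>))"
  define \<zeta> where "\<zeta> = (\<lambda>(x::'a \<Rightarrow> real) i. x (e i) - c)"
  define R where "R = (\<lambda>x. \<Sum>i=1..d. (\<zeta> x i)\<^sup>2)"
  \<comment> \<open>With y = \<open>\<zeta> x / \<tau> x\<close>, inverse stereographic projection
    from \<open>b\<close> is (|y|^2 - 1, 2y) / (|y|^2 + 1), and clearing \<open>\<tau> x\<close>
    gives this formula. Coordinate 0 of \<open>\<zeta>\<close> is determined by the others, since
    all of them sum to 0, and does not enter \<open>R\<close>.\<close>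
  define \<phi> where "\<phi> = (\<lambda>x i. if i = 0 then (R x - (\<tau> x)\<^sup>2) / (R x + (\<tau> x)\<^sup>2)
      else if i \<le> d then 2 * \<tau> x * \<zeta> x i / (R x + (\<tau> x)\<^sup>2) else 0)"
  have Min_\<tau>: "Min (x ` \<sigma>) = c * \<tau> x" for x
    by (simp add: \<tau>_def c_def)
  have \<tau>_le: "c * \<tau> x \<le> x v" if "v \<in> \<sigma>" for x v
    unfolding Min_\<tau>[symmetric] using that assms(2) by simp
  have \<tau>_att: "\<exists>v\<in>\<sigma>. x v = c * \<tau> x" for x
  proof -
    have "Min (x ` \<sigma>) \<in> x ` \<sigma>" using assms(2) \<sigma>ne by (intro Min_in) auto
    then show ?thesis unfolding Min_\<tau> by auto
  qed
  have X: "(\<forall>v. 0 \<le> x v) \<and> (\<forall>v. v \<notin> \<sigma> \<longrightarrow> x v = 0) \<and> sum x \<sigma> = 1" if "x \<in> topspace ?X" for x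
    using that topspace_geometric_simplex[OF assms(2)] by blast
  have \<tau>_nonneg: "0 \<le> \<tau> x" if "x \<in> topspace ?X" for x
    using \<tau>_att[of x] X[OF that] c(1) by (metis zero_le_mult_iff not_less_iff_gr_or_eq less_le_not_le)
  have \<tau>_pos_iff: "\<tau> x > 0 \<longleftrightarrow> {v. x v \<noteq> 0} = \<sigma>" if "x \<in> topspace ?X" for x
  proof
    assume "\<tau> x > 0"
    then have "0 < c * \<tau> x" using c by simp
    then have "x v \<noteq> 0" if "v \<in> \<sigma>" for v
      using \<tau>_le[OF that, of x] by auto
    then show "{v. x v \<noteq> 0} = \<sigma>" using X[OF \<open>x \<in> topspace ?X\<close>] by auto
  next
    assume "{v. x v \<noteq> 0} = \<sigma>"
    then have "\<tau> x \<noteq> 0" using \<tau>_att[of x] by auto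
    with \<tau>_nonneg[OF that] show "\<tau> x > 0" by simp
  qed
  have \<zeta>_sum: "(\<Sum>i\<le>d. \<zeta> x i) = 0" if "x \<in> topspace ?X" for x
    using X[OF that] c by (simp add: \<zeta>_def sum_subtractf flip: sum_e)
  have R_nonneg: "0 \<le> R x" for x
    by (simp add: R_def sum_nonneg)
  \<comment> \<open>A zero denominator would force \<open>\<zeta> x = 0\<close>, so \<open>x\<close>
    would be the barycenter, where \<open>\<tau>\<close> does not vanish.\<close>
  have N_pos: "R x + (\<tau> x)\<^sup>2 > 0" if x: "x \<in> topspace ?X" for x
  proof (rule ccontr)
    assume "\<not> R x + (\<tau> x)\<^sup>2 > 0"
    then have "R x = 0" "\<tau> x = 0"
      using R_nonneg[of x] zero_le_power2[of "\<tau> x"] by (auto simp: add_nonneg_eq_0_iff order.order_iff_strict)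
    then have "\<zeta> x i = 0" if "i \<in> {1..d}" for i
      using that by (simp add: R_def sum_nonneg_eq_0_iff)
    moreover from this have "\<zeta> x 0 = 0"
      using \<zeta>_sum[OF x] by (simp add: split0)
    ultimately have "\<zeta> x i = 0" if "i \<le> d" for i
      using that by (cases "i = 0") auto
    then have "x (e i) = c" if "i \<le> d" for i
      using that by (simp add: \<zeta>_def)
    then have "x v = c" if "v \<in> \<sigma>" for v
      using that e by (auto simp: bij_betw_def)
    then show False using \<tau>_att[of x] \<open>\<tau> x = 0\<close> c by auto
  qed
  have \<phi>_tail: "\<phi> x i = 0" if "i > d" for x i
    using that by (simp add: \<phi>_def)
  have \<phi>_sphere: "(\<Sum>i\<le>d. (\<phi> x i)\<^sup>2) = 1" if "x \<in> topspace ?X" for x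
  proof -
    let ?N = "R x + (\<tau> x)\<^sup>2"
    have "(\<Sum>i=1..d. (\<phi> x i)\<^sup>2) = (\<Sum>i=1..d. 4 * (\<tau> x)\<^sup>2 / ?N\<^sup>2 * (\<zeta> x i)\<^sup>2)"
      by (rule sum.cong) (auto simp: \<phi>_def power_divide power_mult_distrib)
    also have "\<dots> = 4 * (\<tau> x)\<^sup>2 / ?N\<^sup>2 * R x"
      by (simp add: R_def sum_distrib_left)
    finally have "(\<Sum>i\<le>d. (\<phi> x i)\<^sup>2) = ((R x - (\<tau> x)\<^sup>2)\<^sup>2 + 4 * (\<tau> x)\<^sup>2 * R x) / ?N\<^sup>2"
      unfolding split0 by (simp add: \<phi>_def power_divide add_divide_distrib)
    also have "(R x - (\<tau> x)\<^sup>2)\<^sup>2 + 4 * (\<tau> x)\<^sup>2 * R x = ?N\<^sup>2"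
      by (simp add: power2_eq_square algebra_simps)
    finally show ?thesis using N_pos[OF that] by simp
  qed
  have cont: "continuous_map ?X (nsphere d) \<phi>"
  proof -
    have ct: "continuous_map ?X euclideanreal \<tau>"
      unfolding \<tau>_def
      by (intro continuous_map_real_mult continuous_map_canonical_const continuous_map_Min
          continuous_map_coordinate assms(2) \<sigma>ne)
    have cz: "continuous_map ?X euclideanreal (\<lambda>x. \<zeta> x i)" for i
      unfolding \<zeta>_def
      by (intro continuous_map_diff continuous_map_canonical_const continuous_map_coordinate)
    have cR: "continuous_map ?X euclideanreal R"
      unfolding R_def by (intro continuous_map_sum continuous_map_real_pow cz) simp
    have cN: "continuous_map ?X euclideanreal (\<lambda>x. R x + (\<tau> x)\<^sup>2)"
      by (intro continuous_map_add continuous_map_real_pow cR ct)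
    have "continuous_map ?X euclideanreal (\<lambda>x. \<phi> x i)" for i
    proof -
      consider "i = 0" | "i \<noteq> 0" "i \<le> d" | "i > d" by linarith
      then show ?thesis
      proof cases
        case 1
        have "continuous_map ?X euclideanreal (\<lambda>x. (R x - (\<tau> x)\<^sup>2) / (R x + (\<tau> x)\<^sup>2))"
          by (intro continuous_map_real_divide continuous_map_diff continuous_map_real_pow cR ct cN)
            (use N_pos in force)
        then show ?thesis using 1 by (simp add: \<phi>_def)
      next
        case 2
        have "continuous_map ?X euclideanreal (\<lambda>x. 2 * \<tau> x * \<zeta> x i / (R x + (\<tau> x)\<^sup>2))"
          by (intro continuous_map_real_divide continuous_map_real_mult continuous_map_canonical_const ct cz cN)
            (use N_pos in force)
        then show ?thesis using 2 by (simp add: \<phi>_def)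
      next
        case 3
        then show ?thesis by (simp add: \<phi>_tail)
      qed
    qed
    then show ?thesis
      using \<phi>_sphere \<phi>_tail
      by (auto simp: nsphere continuous_map_in_subtopology continuous_map_componentwise_UNIV)
  qed
  have one_minus: "1 - \<phi> x 0 = 2 * (\<tau> x)\<^sup>2 / (R x + (\<tau> x)\<^sup>2)" if "x \<in> topspace ?X" for x
    using N_pos[OF that] by (simp add: \<phi>_def field_simps)
  have base_iff: "\<phi> x = b \<longleftrightarrow> {v. x v \<noteq> 0} \<noteq> \<sigma>" if x: "x \<in> topspace ?X" for x
  proof -
    have "\<phi> x = b \<longleftrightarrow> \<tau> x = 0"
    proof
      assume "\<phi> x = b"
      then have "1 - \<phi> x 0 = 0" by (simp add: b_def)
      then show "\<tau> x = 0" using one_minus[OF x] N_pos[OF x] by simp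
    next
      assume "\<tau> x = 0"
      then show "\<phi> x = b" using N_pos[OF x] by (auto simp: \<phi>_def b_def)
    qed
    then show ?thesis using \<tau>_pos_iff[OF x] \<tau>_nonneg[OF x] by linarith
  qed
  \<comment> \<open>Stereographic projection of the image recovers
    \<open>\<zeta> x / \<tau> x\<close>.\<close>
  have ratio: "\<phi> x i / (1 - \<phi> x 0) = \<zeta> x i / \<tau> x"
    if "x \<in> topspace ?X" "\<tau> x > 0" "i \<in> {1..d}" for x i
  proof -
    have "2 * \<tau> x * \<zeta> x i / N / (2 * (\<tau> x)\<^sup>2 / N) = \<zeta> x i / \<tau> x" if "N > 0" for N
      using that \<open>\<tau> x > 0\<close> by (simp add: power2_eq_square)
    from this[OF N_pos[OF that(1)]] show ?thesis
      using that(3) by (simp add: one_minus[OF that(1)]) (simp add: \<phi>_def)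
  qed
  have inj: "x = y"
    if x: "x \<in> topspace ?X" and y: "y \<in> topspace ?X" and eq: "\<phi> x = \<phi> y" and nb: "\<phi> x \<noteq> b" for x y
  proof -
    have tx: "\<tau> x > 0" and ty: "\<tau> y > 0"
      using nb eq base_iff \<tau>_pos_iff x y by metis+
    have r: "\<zeta> x i / \<tau> x = \<zeta> y i / \<tau> y" if "i \<in> {1..d}" for i
      using ratio[OF x tx that] ratio[OF y ty that] eq by simp
    have z0: "\<zeta> z 0 / \<tau> z = - (\<Sum>i=1..d. \<zeta> z i / \<tau> z)" if "z \<in> topspace ?X" for z
    proof -
      have "\<zeta> z 0 = - (\<Sum>i=1..d. \<zeta> z i)"
        using \<zeta>_sum[OF that] unfolding split0 by linarith
      then show ?thesis by (simp add: sum_divide_distrib)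
    qed
    have "\<zeta> x 0 / \<tau> x = \<zeta> y 0 / \<tau> y"
      unfolding z0[OF x] z0[OF y] using r by simp
    with r have "\<zeta> x i / \<tau> x = \<zeta> y i / \<tau> y" if "i \<le> d" for i
      using that by (cases "i = 0") auto
    then have rv: "(x v - c) / \<tau> x = (y v - c) / \<tau> y" if "v \<in> \<sigma>" for v
      using that e by (auto simp: bij_betw_def \<zeta>_def)
    \<comment> \<open>The ratios determine \<open>\<tau>\<close>: the smallest of them is
      \<open>(c * \<tau> z - c) / \<tau> z\<close>, which is strictly increasing in
      \<open>\<tau> z\<close>.\<close>
    have le: "\<tau> z \<le> \<tau> w" if "\<tau> z > 0" "\<tau> w > 0"
      "\<And>v. v \<in> \<sigma> \<Longrightarrow> (z v - c) / \<tau> z = (w v - c) / \<tau> w" for z w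
    proof -
      obtain u where u: "u \<in> \<sigma>" "w u = c * \<tau> w" using \<tau>_att by blast
      have "(c * \<tau> z - c) / \<tau> z \<le> (z u - c) / \<tau> z"
        using \<tau>_le[OF u(1), of z] that(1) by (simp add: divide_right_mono)
      also have "\<dots> = (c * \<tau> w - c) / \<tau> w"
        using that(3)[OF u(1)] u(2) by simp
      finally show ?thesis
        using that(1,2) c(1) by (simp add: field_simps)
    qed
    have "\<tau> x = \<tau> y"
      using le[of x y] le[of y x] tx ty rv by fastforce
    then have "x v = y v" if "v \<in> \<sigma>" for v
      using rv[OF that] tx by simp
    then show "x = y"
      using X[OF x] X[OF y] by (metis ext)
  qed
  \<comment> \<open>For \<open>d = 0\<close> the simplex is a point without boundary and goes to -1,
    so \<open>b\<close> is not a value; hence the exclusion of \<open>b\<close>.\<close>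
  have onto: "\<exists>x\<in>topspace ?X. \<phi> x = p" if p: "p \<in> topspace (nsphere d)" "p \<noteq> b" for p
  proof -
    have p1: "(\<Sum>i\<le>d. (p i)\<^sup>2) = 1" and p_tail: "\<And>i. i > d \<Longrightarrow> p i = 0"
      using p(1) by (auto simp: nsphere)
    have rest: "(\<Sum>i=1..d. (p i)\<^sup>2) = 1 - (p 0)\<^sup>2"
      using p1 by (simp add: split0)
    have "p 0 \<le> 1"
    proof (rule ccontr)
      assume "\<not> p 0 \<le> 1"
      then have "1 < (p 0)\<^sup>2" by (simp add: one_less_power)
      moreover have "0 \<le> (\<Sum>i=1..d. (p i)\<^sup>2)" by (simp add: sum_nonneg)
      ultimately show False using rest by simp
    qed
    moreover have "p 0 \<noteq> 1"
    proof
      assume "p 0 = 1"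
      then have "p i = 0" if "i \<in> {1..d}" for i
        using rest that by (simp add: sum_nonneg_eq_0_iff)
      then have "p = b"
        using \<open>p 0 = 1\<close> p_tail by (intro ext) (metis atLeastAtMost_iff b_def less_one not_le)
      with p(2) show False by simp
    qed
    ultimately have p0: "1 - p 0 > 0" by simp
    \<comment> \<open>The stereographic projection of \<open>p\<close>, completed by a coordinate 0
      that makes the sum vanish.\<close>
    define z where "z = (\<lambda>i. if i = 0 then - (\<Sum>i=1..d. p i / (1 - p 0)) else p i / (1 - p 0))"
    have z_sum: "(\<Sum>i\<le>d. z i) = 0"
      by (simp add: split0 z_def)
    define \<mu> where "\<mu> = Min (z ` {..d})"
    have \<mu>_le: "\<mu> \<le> z i" if "i \<le> d" for i
      using that by (simp add: \<mu>_def)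
    have "real (Suc d) * \<mu> \<le> (\<Sum>i\<le>d. z i)"
      using sum_bounded_below[of "{..d}" \<mu> z] \<mu>_le by simp
    then have "1 - real (Suc d) * \<mu> > 0" using z_sum by simp
    \<comment> \<open>The preimage is sought as \<open>c + t * z\<close>, whose least coordinate is
      \<open>c + t * \<mu>\<close>. It must equal \<open>c * t\<close> for the point to have
      \<open>\<tau>\<close>-value \<open>t\<close>; solving for \<open>t\<close> gives this value.
      The denominator is positive because the minimum \<open>\<mu>\<close> of numbers with sum 0 is
      at most 0.\<close>
    define t where "t = 1 / (1 - real (Suc d) * \<mu>)"
    have t: "t > 0" and t\<mu>: "t * (real (Suc d) * \<mu>) = t - 1"
      using \<open>1 - real (Suc d) * \<mu> > 0\<close> by (auto simp: t_def field_simps)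
    have c\<mu>: "c + t * \<mu> = c * t"
    proof -
      have "c * (t * (real (Suc d) * \<mu>)) = (real (Suc d) * c) * (t * \<mu>)"
        by (simp only: ac_simps)
      then have "c + t * \<mu> = c * (1 + t * (real (Suc d) * \<mu>))"
        unfolding c(2) by (simp only: distrib_left mult_1_right mult_1_left)
      then show ?thesis unfolding t\<mu> by simp
    qed
    define x where "x = (\<lambda>v. if v \<in> \<sigma> then c + t * z (inv_into {..d} e v) else 0)"
    have xe: "x (e i) = c + t * z i" if "i \<le> d" for i
      using that e e\<sigma> by (simp add: x_def bij_betw_def inv_into_f_f)
    have \<mu>_in: "\<exists>i\<le>d. z i = \<mu>"
    proof -
      have "\<mu> \<in> z ` {..d}" unfolding \<mu>_def by (intro Min_in) auto
      then show ?thesis by auto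
    qed
    have x_ge: "c * t \<le> x v" if v: "v \<in> \<sigma>" for v
    proof -
      obtain i where "i \<le> d" "v = e i" using v e by (auto simp: bij_betw_def)
      then show ?thesis using xe \<mu>_le[of i] t by (simp flip: c\<mu>)
    qed
    have "Min (x ` \<sigma>) = c * t"
    proof (rule Min_eqI)
      obtain i where i: "i \<le> d" "z i = \<mu>" using \<mu>_in by blast
      then show "c * t \<in> x ` \<sigma>"
        using xe[of i] e\<sigma>[of i] by (metis c\<mu> image_eqI)
    qed (use x_ge assms(2) in auto)
    then have \<tau>x: "\<tau> x = t" using c(1) by (simp add: Min_\<tau>)
    have x_in: "x \<in> topspace ?X"
      unfolding topspace_geometric_simplex[OF assms(2)]
    proof (intro conjI allI impI)
      show "0 \<le> x v" for v
        using x_ge[of v] c t by (cases "v \<in> \<sigma>") (auto simp: x_def intro: order_trans[rotated])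
      show "sum x \<sigma> = 1"
        using xe z_sum c(2) by (simp add: sum_e sum.distrib flip: sum_distrib_left)
    qed (simp add: x_def)
    have \<zeta>x: "\<zeta> x i = t * z i" if "i \<le> d" for i
      using xe[OF that] by (simp add: \<zeta>_def)
    define Z where "Z = (\<Sum>i=1..d. (z i)\<^sup>2)"
    have Rx: "R x = t\<^sup>2 * Z"
      by (simp add: R_def Z_def \<zeta>x power_mult_distrib flip: sum_distrib_left)
    have Z: "Z = (1 + p 0) / (1 - p 0)"
    proof -
      have "Z = (1 - (p 0)\<^sup>2) / (1 - p 0)\<^sup>2"
        unfolding rest[symmetric] Z_def by (simp add: z_def power_divide sum_divide_distrib)
      also have "1 - (p 0)\<^sup>2 = (1 + p 0) * (1 - p 0)"
        by (simp add: power2_eq_square algebra_simps)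
      also have "(1 + p 0) * (1 - p 0) / (1 - p 0)\<^sup>2 = (1 + p 0) / (1 - p 0)"
        using p0 by (simp add: power2_eq_square)
      finally show ?thesis .
    qed
    have Nx: "R x + (\<tau> x)\<^sup>2 = t\<^sup>2 * (2 / (1 - p 0))" "R x - (\<tau> x)\<^sup>2 = t\<^sup>2 * (2 * p 0 / (1 - p 0))"
      unfolding Rx \<tau>x Z using p0 by (simp_all add: field_simps)
    have "\<phi> x i = p i" for i
    proof -
      consider "i = 0" | "i \<noteq> 0" "i \<le> d" | "i > d" by linarith
      then show ?thesis
      proof cases
        case 1
        then show ?thesis unfolding \<phi>_def Nx using p0 t by simp
      next
        case 2
        then show ?thesis unfolding \<phi>_def Nx using p0 t
          by (simp add: \<tau>x \<zeta>x z_def power2_eq_square)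
      next
        case 3
        then show ?thesis by (simp add: \<phi>_tail p_tail)
      qed
    qed
    then show ?thesis using x_in by blast
  qed
  show thesis
    by (rule that[OF cont base_iff inj onto])
qed

section \<open>Critical facets, their depth functions and collars\<close>

text \<open>The topological half, free of graphs: by maximality every proper face of a member of
  \<open>T\<close> lies in \<open>K - T\<close>, so \<open>X\<close> arises from \<open>A\<close> by
  attaching d-cells along the boundaries of the facets in \<open>T\<close>.\<close>

locale critical_facets =
  fixes V :: "'a set" and K T :: "'a set set" and d :: nat
  assumes K: "complex_on V K" and T_subset: "T \<subseteq> K" and card_T: "\<And>\<sigma>. \<sigma> \<in> T \<Longrightarrow> card \<sigma> = Suc d"
    and maximal: "\<And>\<sigma> \<rho>. \<lbrakk>\<sigma> \<in> T; \<rho> \<in> K; \<sigma> \<subseteq> \<rho>\<rbrakk> \<Longrightarrow> \<rho> = \<sigma>"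
begin

abbreviation X :: "('a \<Rightarrow> real) topology" where "X \<equiv> geometric_realization K"
abbreviation A :: "('a \<Rightarrow> real) topology" where "A \<equiv> geometric_realization (K - T)"

lemma finite_V: "finite V" and finite_T: "finite T"
  using K T_subset complex_on_finite[OF K] by (auto simp: complex_on_def intro: finite_subset)

lemma T_face: assumes "\<sigma> \<in> T" shows "\<sigma> \<subseteq> V" "finite \<sigma>" "\<sigma> \<noteq> {}" "\<sigma> \<in> K"
proof -
  show "\<sigma> \<in> K" using assms T_subset by blast
  then show "\<sigma> \<subseteq> V" using K by (auto simp: complex_on_def)
  show "finite \<sigma>" "\<sigma> \<noteq> {}" using card_T[OF assms] by (auto intro: card_ge_0_finite)
qed

lemma complex_A: "complex_on V (K - T)"
  unfolding complex_on_def
proof (intro conjI ballI allI impI)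
  fix F F' assume F: "F \<in> K - T" "F' \<subseteq> F"
  then have "F' \<in> K" using K by (auto simp: complex_on_def)
  moreover have "F' \<notin> T" using F maximal[of F' F] by blast
  ultimately show "F' \<in> K - T" by blast
qed (use K in \<open>auto simp: complex_on_def\<close>)

lemmas X_iff = topspace_geometric_realization[OF K]
lemmas A_iff = topspace_geometric_realization[OF complex_A]

lemma A_subset_X: "x \<in> topspace A \<Longrightarrow> x \<in> topspace X"
  by (simp add: X_iff A_iff)

text \<open>The largest multiple of the barycenter \<open>bary \<sigma>\<close> that can be
  subtracted from \<open>x\<close> while keeping the coordinates over \<open>\<sigma>\<close>
  nonnegative.\<close>

definition depth :: "'a set \<Rightarrow> ('a \<Rightarrow> real) \<Rightarrow> real" where
  "depth \<sigma> x = real (Suc d) * Min (x ` \<sigma>)"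

definition tdepth :: "('a \<Rightarrow> real) \<Rightarrow> real" where
  "tdepth x = (\<Sum>\<sigma>\<in>T. depth \<sigma> x)"

definition bary :: "'a set \<Rightarrow> 'a \<Rightarrow> real" where
  "bary \<sigma> v = (if v \<in> \<sigma> then 1 / real (Suc d) else 0)"

lemma depth_le: "\<lbrakk>\<sigma> \<in> T; v \<in> \<sigma>\<rbrakk> \<Longrightarrow> depth \<sigma> x * bary \<sigma> v \<le> x v"
  using T_face(2)[of \<sigma>] by (simp add: depth_def bary_def)

lemma depth_attained:
  assumes "\<sigma> \<in> T"
  obtains u where "u \<in> \<sigma>" "x u = depth \<sigma> x * bary \<sigma> u"
proof -
  have "Min (x ` \<sigma>) \<in> x ` \<sigma>"
    using T_face[OF assms] by (intro Min_in) auto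
  then obtain u where "u \<in> \<sigma>" "x u = Min (x ` \<sigma>)" by auto
  then show thesis using that by (simp add: depth_def bary_def)
qed

lemma sum_bary: assumes "\<sigma> \<in> T" shows "sum (bary \<sigma>) V = 1"
proof -
  have "sum (bary \<sigma>) V = sum (bary \<sigma>) \<sigma>"
    by (rule sum.mono_neutral_right) (use T_face[OF assms] finite_V in \<open>auto simp: bary_def\<close>)
  then show ?thesis by (simp add: bary_def card_T[OF assms])
qed

lemma depth_nonneg: assumes "\<sigma> \<in> T" "x \<in> topspace X" shows "0 \<le> depth \<sigma> x"
proof -
  obtain u where "u \<in> \<sigma>" "x u = depth \<sigma> x * bary \<sigma> u"
    using depth_attained[OF assms(1)] by blast
  moreover have "0 \<le> x u" using assms(2) by (simp add: X_iff)
  ultimately show ?thesis by (simp add: bary_def zero_le_mult_iff zero_le_divide_iff)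
qed

text \<open>Positive depth puts \<open>\<sigma>\<close> inside the support, and maximality turns the
  inclusion into equality. So at any point at most one depth is nonzero.\<close>

lemma depth_pos_support:
  assumes "\<sigma> \<in> T" "x \<in> topspace X"
  shows "depth \<sigma> x > 0 \<longleftrightarrow> {v. x v \<noteq> 0} = \<sigma>"
proof
  assume pos: "depth \<sigma> x > 0"
  have "x v \<noteq> 0" if "v \<in> \<sigma>" for v
    using depth_le[OF assms(1) that, of x] pos that by (auto simp: bary_def field_simps)
  then have "\<sigma> \<subseteq> {v. x v \<noteq> 0}" by blast
  then show "{v. x v \<noteq> 0} = \<sigma>"
    using maximal[OF assms(1)] assms(2) by (simp add: X_iff)
next
  assume supp: "{v. x v \<noteq> 0} = \<sigma>"
  obtain u where "u \<in> \<sigma>" "x u = depth \<sigma> x * bary \<sigma> u"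
    using depth_attained[OF assms(1)] by blast
  then have "depth \<sigma> x \<noteq> 0" using supp by auto
  then show "depth \<sigma> x > 0" using depth_nonneg[OF assms] by simp
qed

lemma point_cases:
  assumes "x \<in> topspace X"
  obtains (subcomplex) "x \<in> topspace A" "tdepth x = 0" "\<And>\<sigma>. \<sigma> \<in> T \<Longrightarrow> depth \<sigma> x = 0"
  | (facet) \<sigma> where "\<sigma> \<in> T" "{v. x v \<noteq> 0} = \<sigma>" "x \<notin> topspace A" "tdepth x > 0" "tdepth x \<le> 1"
      "\<And>\<rho>. \<rho> \<in> T \<Longrightarrow> depth \<rho> x = (if \<rho> = \<sigma> then tdepth x else 0)"
proof (cases "{v. x v \<noteq> 0} \<in> T")
  case False
  then have "depth \<sigma> x = 0" if "\<sigma> \<in> T" for \<sigma>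
    using depth_pos_support[OF that assms] depth_nonneg[OF that assms] that by fastforce
  then show ?thesis
    using False assms by (intro subcomplex) (auto simp: tdepth_def A_iff X_iff)
next
  case True
  define \<sigma> where "\<sigma> = {v. x v \<noteq> 0}"
  have \<sigma>: "\<sigma> \<in> T" using True by (simp add: \<sigma>_def)
  have zero: "depth \<rho> x = 0" if "\<rho> \<in> T" "\<rho> \<noteq> \<sigma>" for \<rho>
    using depth_pos_support[OF that(1) assms] depth_nonneg[OF that(1) assms] that by (auto simp: \<sigma>_def)
  have "tdepth x = (\<Sum>\<rho>\<in>{\<sigma>}. depth \<rho> x)"
    unfolding tdepth_def by (rule sum.mono_neutral_right) (use finite_T \<sigma> zero in auto)
  then have t: "tdepth x = depth \<sigma> x" by simp
  have "depth \<sigma> x * bary \<sigma> v \<le> x v" for v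
    using depth_le[OF \<sigma>, of v x] assms by (cases "v \<in> \<sigma>") (auto simp: bary_def X_iff)
  then have "(\<Sum>v\<in>V. depth \<sigma> x * bary \<sigma> v) \<le> sum x V"
    by (intro sum_mono) auto
  then have "depth \<sigma> x \<le> 1"
    using assms sum_bary[OF \<sigma>] by (simp add: X_iff flip: sum_distrib_left)
  moreover have "depth \<sigma> x > 0"
    using depth_pos_support[OF \<sigma> assms] by (simp add: \<sigma>_def)
  ultimately show ?thesis
    using \<sigma> zero t True by (intro facet[of \<sigma>]) (auto simp: \<sigma>_def A_iff)
qed

text \<open>In a critical facet, depth is 0 on the boundary and 1 at the barycenter, \<open>project\<close> is the radial
  projection from the barycenter to the boundary, and \<open>stretch s\<close> expands the points of depth at least
  \<open>s / 2\<close> onto the whole facet. At most one summand over T is nonzero, so that summing gives continuous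
  formulas on the whole complex.\<close>

definition radial :: "('a \<Rightarrow> real) \<Rightarrow> 'a \<Rightarrow> real" where
  "radial x v = (\<Sum>\<sigma>\<in>T. depth \<sigma> x * bary \<sigma> v)"

definition project :: "('a \<Rightarrow> real) \<Rightarrow> 'a \<Rightarrow> real" where
  "project x v = (x v - radial x v) / (1 - tdepth x)"

definition stretch :: "real \<Rightarrow> ('a \<Rightarrow> real) \<Rightarrow> 'a \<Rightarrow> real" where
  "stretch s x v = ((\<Sum>\<sigma>\<in>T. max 0 (depth \<sigma> x - s / 2) * bary \<sigma> v) + (x v - radial x v)) / (1 - s / 2)"

lemma sum_facet:
  fixes f :: "'a set \<Rightarrow> real"
  assumes "\<sigma> \<in> T" "\<And>\<rho>. \<rho> \<in> T \<Longrightarrow> \<rho> \<noteq> \<sigma> \<Longrightarrow> f \<rho> = 0"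
  shows "(\<Sum>\<rho>\<in>T. f \<rho>) = f \<sigma>"
proof -
  have "(\<Sum>\<rho>\<in>T. f \<rho>) = (\<Sum>\<rho>\<in>{\<sigma>}. f \<rho>)"
    by (rule sum.mono_neutral_right) (use finite_T assms in auto)
  then show ?thesis by simp
qed

lemma project_A: assumes "x \<in> topspace A" shows "project x = x" "tdepth x = 0"
proof -
  have "tdepth x = 0 \<and> (\<forall>\<sigma>\<in>T. depth \<sigma> x = 0)"
    using A_subset_X[OF assms] by (cases rule: point_cases) (use assms in auto)
  then show "tdepth x = 0" "project x = x"
    by (auto simp: project_def radial_def)
qed

text \<open>Subtracting depth times barycenter kills the coordinate that attains the minimum, so the
  support loses a vertex of the critical facet. Depth below 1 leaves positive mass for the
  normalization.\<close>

lemma project_in_A: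
  assumes "x \<in> topspace X" "tdepth x < 1"
  shows "project x \<in> topspace A"
  using assms(1)
proof (cases rule: point_cases)
  case subcomplex
  then show ?thesis by (simp add: project_A)
next
  case (facet \<sigma>)
  let ?t = "tdepth x"
  have r: "radial x v = ?t * bary \<sigma> v" for v
    unfolding radial_def using facet by (subst sum_facet[of \<sigma>]) auto
  obtain u where u: "u \<in> \<sigma>" "x u = ?t * bary \<sigma> u"
    using depth_attained[OF facet(1), of x] facet(1,6) by auto
  have out: "x v = 0" "bary \<sigma> v = 0" if "v \<notin> \<sigma>" for v
    using that facet(2) by (auto simp: bary_def)
  show ?thesis
  proof (rule geometric_realizationI[OF complex_A])
    show "0 \<le> project x v" for v
      using depth_le[OF facet(1), of v x] facet(1,6) assms(2) out[of v]
      by (cases "v \<in> \<sigma>") (auto simp: project_def r)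
    have "\<sigma> - {u} \<in> K"
      using K T_face(4)[OF facet(1)] by (auto simp: complex_on_def)
    moreover have "\<sigma> - {u} \<notin> T"
      using maximal[of "\<sigma> - {u}" \<sigma>] T_face(4)[OF facet(1)] u(1) by blast
    ultimately show "\<sigma> - {u} \<in> K - T" by blast
    show "project x v = 0" if "v \<notin> \<sigma> - {u}" for v
      using that out[of v] u by (cases "v \<in> \<sigma>") (auto simp: project_def r)
    have "sum (project x) V = (sum x V - ?t * sum (bary \<sigma>) V) / (1 - ?t)"
      by (simp add: project_def r sum_subtractf sum_distrib_left flip: sum_divide_distrib)
    then show "sum (project x) V = 1"
      using assms by (simp add: X_iff sum_bary[OF facet(1)])
  qed
qed

text \<open>A point of a critical facet is a boundary part plus \<open>tdepth x\<close> times the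
  barycenter. Stretching keeps the boundary part, lowers the weight of the barycenter by
  \<open>s / 2\<close>, and divides by the remaining mass \<open>1 - s / 2\<close>; the lower bound
  on the depth keeps that weight nonnegative.\<close>

lemma stretch_in_X:
  assumes "x \<in> topspace X" "0 \<le> s" "s \<le> 1" "s / 2 \<le> tdepth x"
  shows "stretch s x \<in> topspace X"
  using assms(1)
proof (cases rule: point_cases)
  case subcomplex
  then have "stretch s x = x"
    using assms by (auto simp: stretch_def radial_def)
  then show ?thesis using assms(1) by simp
next
  case (facet \<sigma>)
  let ?t = "tdepth x"
  have r: "radial x v = ?t * bary \<sigma> v" for v
    unfolding radial_def using facet by (subst sum_facet[of \<sigma>]) auto
  have m: "(\<Sum>\<rho>\<in>T. max 0 (depth \<rho> x - s / 2) * bary \<rho> v) = (?t - s / 2) * bary \<sigma> v" for v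
    using facet assms by (subst sum_facet[of \<sigma>]) (auto simp: max_def)
  have s: "stretch s x v = ((?t - s / 2) * bary \<sigma> v + (x v - ?t * bary \<sigma> v)) / (1 - s / 2)" for v
    by (simp add: stretch_def m r)
  have out: "x v = 0" "bary \<sigma> v = 0" if "v \<notin> \<sigma>" for v
    using that facet(2) by (auto simp: bary_def)
  show ?thesis
  proof (rule geometric_realizationI[OF K _ T_face(4)[OF facet(1)]])
    show "0 \<le> stretch s x v" for v
    proof (cases "v \<in> \<sigma>")
      case True
      have "0 \<le> x v - ?t * bary \<sigma> v"
        using depth_le[OF facet(1) True, of x] facet(1,6) by simp
      moreover have "0 \<le> (?t - s / 2) * bary \<sigma> v"
        using assms(4) by (simp add: bary_def)
      ultimately show ?thesis using assms(3) by (simp add: s)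
    qed (simp add: s out)
    show "stretch s x v = 0" if "v \<notin> \<sigma>" for v
      using out[OF that] by (simp add: s)
    have "sum (stretch s x) V = ((?t - s / 2) * sum (bary \<sigma>) V + (sum x V - ?t * sum (bary \<sigma>) V)) / (1 - s / 2)"
      by (simp add: s sum_subtractf sum.distrib sum_distrib_left flip: sum_divide_distrib)
    then show "sum (stretch s x) V = 1"
      using assms by (simp add: X_iff sum_bary[OF facet(1)])
  qed
qed

lemma stretch_0: assumes "x \<in> topspace X" shows "stretch 0 x = x"
  using depth_nonneg[OF _ assms] by (auto simp: stretch_def radial_def max_def)

text \<open>The two pieces of the extended homotopy meet at depth \<open>s / 2\<close>, where no
  weight is left on the barycenter.\<close>

lemma stretch_eq_project:
  assumes "x \<in> topspace X" "tdepth x = s / 2"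
  shows "stretch s x = project x"
proof -
  have "depth \<sigma> x \<le> s / 2" if "\<sigma> \<in> T" for \<sigma>
    unfolding assms(2)[symmetric] tdepth_def using that finite_T depth_nonneg[OF _ assms(1)]
    by (intro member_le_sum) auto
  then have "(\<Sum>\<sigma>\<in>T. max 0 (depth \<sigma> x - s / 2) * bary \<sigma> v) = 0" for v
    by (intro sum.neutral ballI) (simp add: max_absorb1)
  then show ?thesis
    using assms(2) by (auto simp: stretch_def project_def)
qed

lemma continuous_depth: "\<sigma> \<in> T \<Longrightarrow> continuous_map X euclideanreal (depth \<sigma>)"
  unfolding depth_def
  by (intro continuous_map_real_mult continuous_map_canonical_const continuous_map_Min
      continuous_map_coordinate T_face)

lemma continuous_tdepth: "continuous_map X euclideanreal tdepth"
  unfolding tdepth_def by (intro continuous_map_sum continuous_depth finite_T)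

lemma continuous_radial: "continuous_map X euclideanreal (\<lambda>x. radial x v)"
  unfolding radial_def
  by (intro continuous_map_sum continuous_map_real_mult continuous_depth finite_T continuous_map_canonical_const)

text \<open>The homotopy extension property for the subcomplex, with a contraction of the subcomplex run
  on collars of the critical facets.\<close>

lemma extend_contraction:
  assumes "contractible_space A"
  obtains H a where "continuous_map (prod_topology (top_of_set {0..1::real}) X) X H"
    and "\<And>x. x \<in> topspace X \<Longrightarrow> H (0, x) = x"
    and "\<And>s x. \<lbrakk>s \<in> {0..1}; x \<in> topspace A\<rbrakk> \<Longrightarrow> H (s, x) \<in> topspace A"
    and "\<And>x. x \<in> topspace A \<Longrightarrow> H (1, x) = a"
proof -
  let ?I = "top_of_set {0..1::real}"
  obtain h a where h: "continuous_map (prod_topology ?I A) A h"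
    and h0: "\<And>x. h (0, x) = x" and h1: "\<And>x. h (1, x) = a"
    using assms unfolding contractible_space_def homotopic_with_def by auto
  let ?Y = "prod_topology ?I X"
  \<comment> \<open>At time \<open>s\<close> the collar consists of the points of depth at most
    \<open>s / 2\<close>. There the contraction runs on the projected point for time
    \<open>s - 2 * tdepth x\<close>, which is the full time \<open>s\<close> on the subcomplex and 0
    at the inner edge, where \<open>h\<close> is the identity and \<open>f\<close> meets
    \<open>g\<close>. The collar never exceeds depth 1/2, so it avoids the barycenter, at which
    \<open>project\<close> has denominator 0.\<close>
  define f where "f = (\<lambda>(s, x). h (s - 2 * tdepth x, project x))"
  define g where "g = (\<lambda>(s, x). stretch s x)"
  define H where "H = (\<lambda>z. if tdepth (snd z) \<le> fst z / 2 then f z else g z)"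
  have c_fst: "continuous_map ?Y euclideanreal fst"
    by (rule continuous_map_into_fulltopology[OF continuous_map_fst])
  have c_snd: "continuous_map ?Y euclideanreal (\<lambda>z. k (snd z))" if "continuous_map X euclideanreal k" for k
    using continuous_map_compose[OF continuous_map_snd that] by (simp add: o_def)
  have c_half: "continuous_map ?Y euclideanreal (\<lambda>z. fst z / 2)"
    by (intro continuous_map_real_divide c_fst continuous_map_canonical_const) simp
  have "continuous_map ?Y X H"
    unfolding H_def
  proof (rule continuous_map_cases_le)
    show "continuous_map ?Y euclideanreal (\<lambda>z. tdepth (snd z))"
      by (rule c_snd[OF continuous_tdepth])
    show "continuous_map ?Y euclideanreal (\<lambda>z. fst z / 2)"
      by (rule c_half)
    let ?L = "{z \<in> topspace ?Y. tdepth (snd z) \<le> fst z / 2}"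
    have L: "tdepth (snd z) < 1" "0 \<le> fst z - 2 * tdepth (snd z)" "fst z - 2 * tdepth (snd z) \<le> 1"
      "snd z \<in> topspace X"
      if "z \<in> topspace (subtopology ?Y ?L)" for z
    proof -
      have z: "0 \<le> fst z" "fst z \<le> 1" "tdepth (snd z) \<le> fst z / 2" and x: "snd z \<in> topspace X"
        using that by auto
      moreover have "0 \<le> tdepth (snd z)"
        unfolding tdepth_def by (intro sum_nonneg depth_nonneg x)
      ultimately show "tdepth (snd z) < 1" "0 \<le> fst z - 2 * tdepth (snd z)"
        "fst z - 2 * tdepth (snd z) \<le> 1" "snd z \<in> topspace X"
        by auto
    qed
    have "continuous_map (subtopology ?Y ?L) (prod_topology ?I A) (\<lambda>z. (fst z - 2 * tdepth (snd z), project (snd z)))"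
    proof (rule continuous_map_pairedI)
      show "continuous_map (subtopology ?Y ?L) ?I (\<lambda>z. fst z - 2 * tdepth (snd z))"
      proof (rule continuous_map_into_subtopology)
        show "continuous_map (subtopology ?Y ?L) euclideanreal (\<lambda>z. fst z - 2 * tdepth (snd z))"
          by (intro continuous_map_from_subtopology continuous_map_diff continuous_map_real_mult
              continuous_map_canonical_const c_fst c_snd[OF continuous_tdepth])
      qed (use L in auto)
      have "continuous_map (subtopology ?Y ?L) euclideanreal (\<lambda>z. project (snd z) v)" for v
        unfolding project_def
      proof (rule continuous_map_real_divide)
        show "continuous_map (subtopology ?Y ?L) euclideanreal (\<lambda>z. snd z v - radial (snd z) v)"
          by (intro continuous_map_from_subtopology continuous_map_diff
              c_snd[OF continuous_map_coordinate] c_snd[OF continuous_radial])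
        show "continuous_map (subtopology ?Y ?L) euclideanreal (\<lambda>z. 1 - tdepth (snd z))"
          by (intro continuous_map_from_subtopology continuous_map_diff
              continuous_map_canonical_const c_snd[OF continuous_tdepth])
        show "1 - tdepth (snd z) \<noteq> 0" if "z \<in> topspace (subtopology ?Y ?L)" for z
          using L(1)[OF that] by simp
      qed
      then show "continuous_map (subtopology ?Y ?L) A (\<lambda>z. project (snd z))"
        unfolding continuous_map_into_realization using L(1,4) project_in_A by blast
    qed
    from continuous_map_compose[OF this h]
    have fA: "continuous_map (subtopology ?Y ?L) A f"
      by (simp add: f_def o_def case_prod_unfold)
    then show "continuous_map (subtopology ?Y ?L) X f"
      unfolding continuous_map_into_realization using A_subset_X by blast
    let ?U = "{z \<in> topspace ?Y. fst z / 2 \<le> tdepth (snd z)}"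
    have "continuous_map (subtopology ?Y ?U) euclideanreal (\<lambda>z. stretch (fst z) (snd z) v)" for v
      unfolding stretch_def
    proof (rule continuous_map_real_divide)
      show "continuous_map (subtopology ?Y ?U) euclideanreal
          (\<lambda>z. (\<Sum>\<sigma>\<in>T. max 0 (depth \<sigma> (snd z) - fst z / 2) * bary \<sigma> v) + (snd z v - radial (snd z) v))"
        by (intro continuous_map_from_subtopology continuous_map_add continuous_map_diff continuous_map_sum
            continuous_map_real_mult continuous_map_real_max continuous_map_canonical_const finite_T c_half
            c_snd[OF continuous_map_coordinate] c_snd[OF continuous_radial] c_snd[OF continuous_depth])
      show "continuous_map (subtopology ?Y ?U) euclideanreal (\<lambda>z. 1 - fst z / 2)"
        by (intro continuous_map_from_subtopology continuous_map_diff continuous_map_canonical_const c_half)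
    qed auto
    moreover have "stretch (fst z) (snd z) \<in> topspace X" if "z \<in> topspace (subtopology ?Y ?U)" for z
      using that by (intro stretch_in_X) auto
    ultimately show "continuous_map (subtopology ?Y ?U) X g"
      unfolding continuous_map_into_realization g_def case_prod_unfold by blast
    show "f z = g z" if "z \<in> topspace ?Y" "tdepth (snd z) = fst z / 2" for z
      using stretch_eq_project[OF _ that(2)] that by (auto simp: f_def g_def h0 case_prod_unfold)
  qed
  moreover have "H (0, x) = x" if x: "x \<in> topspace X" for x
  proof (cases "tdepth x \<le> 0")
    case True
    from x have "x \<in> topspace A"
      by (cases rule: point_cases) (use True in auto)
    then show ?thesis by (simp add: H_def f_def h0 project_A)
  next
    case False
    then show ?thesis by (simp add: H_def g_def stretch_0[OF x])
  qed
  moreover have HA: "H (s, x) = h (s, x)" if "s \<in> {0..1}" "x \<in> topspace A" for s x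
    using that by (simp add: H_def f_def project_A)
  moreover have "h (s, x) \<in> topspace A" if "s \<in> {0..1}" "x \<in> topspace A" for s x
    using continuous_map_image_subset_topspace[OF h] that by auto
  ultimately show thesis
    using h1 by (intro that[of H a]) auto
qed

section \<open>The wedge of spheres as a quotient of the complex\<close>

lemma subtopology_simplex:
  assumes "F \<in> K"
  shows "subtopology X (topspace (geometric_realization (Pow F))) = geometric_realization (Pow F)"
proof -
  have "finite F" "F \<subseteq> V"
    using K assms finite_V by (auto simp: complex_on_def intro: finite_subset)
  have "topspace (geometric_realization (Pow F)) \<subseteq> topspace X"
  proof
    fix x assume "x \<in> topspace (geometric_realization (Pow F))"
    then have x: "\<And>v. 0 \<le> x v" "\<And>v. v \<notin> F \<Longrightarrow> x v = 0" "sum x F = 1"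
      by (auto simp: topspace_geometric_simplex[OF \<open>finite F\<close>])
    have "sum x V = sum x F"
      by (rule sum.mono_neutral_right) (use finite_V \<open>F \<subseteq> V\<close> x in auto)
    with x show "x \<in> topspace X"
      by (intro geometric_realizationI[OF K _ assms]) auto
  qed
  then show ?thesis
    by (simp add: geometric_realization_def subtopology_subtopology Int_absorb1)
qed

lemma support_simplex:
  assumes "x \<in> topspace X"
  shows "x \<in> topspace (geometric_realization (Pow {v. x v \<noteq> 0}))"
proof -
  let ?S = "{v. x v \<noteq> 0}"
  have S: "?S \<subseteq> V" "finite ?S"
    using K assms finite_V by (auto simp: complex_on_def X_iff intro: finite_subset)
  have "sum x V = sum x ?S"
    by (rule sum.mono_neutral_right) (use finite_V S in auto)
  then show ?thesis
    using assms by (simp add: topspace_geometric_simplex[OF S(2)] X_iff)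
qed

text \<open>Sending each critical facet to its own sphere and the rest to the wedge point gives a
  closed continuous surjection \<open>q\<close> whose only nontrivial fibre is \<open>A\<close>. The
  extended contraction keeps \<open>A\<close> inside itself and ends constant on it, so identifying
  \<open>A\<close> to a point does not change the homotopy type.\<close>

lemma homotopy_equivalent_wedge:
  assumes "contractible_complex (K - T)" "T \<noteq> {}"
  shows "X homotopy_equivalent_space wedge_of_spheres (card T) (int d)"
proof -
  let ?m = "card T" and ?S = "nsphere d"
  define b :: "nat \<Rightarrow> real" where "b = (\<lambda>j. if j = 0 then 1 else 0)"
  define p where "p = (\<lambda>(i::nat, x). if x = b then None else Some (i, x))"
  define W where "W = wedge_of_spheres ?m (int d)"
  have W_eq: "W = quotient_topology (sum_topology (\<lambda>_. ?S) {..<?m}) p"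
    by (simp add: W_def wedge_of_spheres_def wedge_def unit_sphere_def p_def b_def)
  have p_quot: "quotient_map (sum_topology (\<lambda>_. ?S) {..<?m}) W p"
    unfolding W_eq by (rule quotient_map_quotient_topology)
  have b_S: "b \<in> topspace ?S"
    unfolding b_def by (rule in_topspace_nsphere)
  have T1: "Hausdorff_space ?S"
    unfolding nsphere_def by (intro Hausdorff_space_subtopology Hausdorff_Euclidean_space)
  have "\<forall>\<sigma>\<in>T. \<exists>\<phi>. continuous_map (geometric_realization (Pow \<sigma>)) ?S \<phi> \<and>
      (\<forall>x\<in>topspace (geometric_realization (Pow \<sigma>)). \<phi> x = b \<longleftrightarrow> {v. x v \<noteq> 0} \<noteq> \<sigma>) \<and>
      (\<forall>x\<in>topspace (geometric_realization (Pow \<sigma>)). \<forall>y\<in>topspace (geometric_realization (Pow \<sigma>)).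
        \<phi> x = \<phi> y \<longrightarrow> \<phi> x \<noteq> b \<longrightarrow> x = y) \<and>
      (\<forall>s\<in>topspace ?S. s \<noteq> b \<longrightarrow> (\<exists>x\<in>topspace (geometric_realization (Pow \<sigma>)). \<phi> x = s))"
  proof
    fix \<sigma> assume "\<sigma> \<in> T"
    show "\<exists>\<phi>. continuous_map (geometric_realization (Pow \<sigma>)) ?S \<phi> \<and>
      (\<forall>x\<in>topspace (geometric_realization (Pow \<sigma>)). \<phi> x = b \<longleftrightarrow> {v. x v \<noteq> 0} \<noteq> \<sigma>) \<and>
      (\<forall>x\<in>topspace (geometric_realization (Pow \<sigma>)). \<forall>y\<in>topspace (geometric_realization (Pow \<sigma>)).
        \<phi> x = \<phi> y \<longrightarrow> \<phi> x \<noteq> b \<longrightarrow> x = y) \<and>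
      (\<forall>s\<in>topspace ?S. s \<noteq> b \<longrightarrow> (\<exists>x\<in>topspace (geometric_realization (Pow \<sigma>)). \<phi> x = s))"
      unfolding b_def
      by (rule simplex_to_sphere[OF T_face(2)[OF \<open>\<sigma> \<in> T\<close>] card_T[OF \<open>\<sigma> \<in> T\<close>]]) blast
  qed
  then obtain \<phi> where \<phi>_all: "\<forall>\<sigma>\<in>T. continuous_map (geometric_realization (Pow \<sigma>)) ?S (\<phi> \<sigma>) \<and>
      (\<forall>x\<in>topspace (geometric_realization (Pow \<sigma>)). \<phi> \<sigma> x = b \<longleftrightarrow> {v. x v \<noteq> 0} \<noteq> \<sigma>) \<and>
      (\<forall>x\<in>topspace (geometric_realization (Pow \<sigma>)). \<forall>y\<in>topspace (geometric_realization (Pow \<sigma>)).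
        \<phi> \<sigma> x = \<phi> \<sigma> y \<longrightarrow> \<phi> \<sigma> x \<noteq> b \<longrightarrow> x = y) \<and>
      (\<forall>s\<in>topspace ?S. s \<noteq> b \<longrightarrow> (\<exists>x\<in>topspace (geometric_realization (Pow \<sigma>)). \<phi> \<sigma> x = s))"
    by (rule bchoice[THEN exE])
  have \<phi>_cont: "continuous_map (geometric_realization (Pow \<sigma>)) ?S (\<phi> \<sigma>)" if "\<sigma> \<in> T" for \<sigma>
    using \<phi>_all that by blast
  have \<phi>_base: "\<phi> \<sigma> x = b \<longleftrightarrow> {v. x v \<noteq> 0} \<noteq> \<sigma>"
    if "\<sigma> \<in> T" "x \<in> topspace (geometric_realization (Pow \<sigma>))" for \<sigma> x
    using \<phi>_all that by blast
  have \<phi>_inj: "x = y" if "\<sigma> \<in> T" "x \<in> topspace (geometric_realization (Pow \<sigma>))"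
    "y \<in> topspace (geometric_realization (Pow \<sigma>))" "\<phi> \<sigma> x = \<phi> \<sigma> y" "\<phi> \<sigma> x \<noteq> b" for \<sigma> x y
    using \<phi>_all that by blast
  have \<phi>_onto: "\<exists>x\<in>topspace (geometric_realization (Pow \<sigma>)). \<phi> \<sigma> x = s"
    if "\<sigma> \<in> T" "s \<in> topspace ?S" "s \<noteq> b" for \<sigma> s
    using \<phi>_all that by blast
  obtain f where f: "bij_betw f T {..<?m}"
    using ex_bij_betw_finite_nat[OF finite_T] by (auto simp: atLeast0LessThan)
  have f_lt: "f \<sigma> < ?m" if "\<sigma> \<in> T" for \<sigma>
    using f that by (auto simp: bij_betw_def)
  define q where "q = (\<lambda>x. let S = {v. x v \<noteq> 0} in if S \<in> T then Some (f S, \<phi> S x) else None)"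
  have q_A: "q x = None" if "x \<in> topspace A" for x
    using that by (simp add: q_def A_iff)
  \<comment> \<open>This includes the boundary of \<open>\<sigma>\<close>, whose points have
    supports outside \<open>T\<close> and are sent to \<open>b\<close> by
    \<open>\<phi> \<sigma>\<close>; so the definition of \<open>q\<close> by supports is compatible
    with the closed facets.\<close>
  have q_simplex: "q x = p (f \<sigma>, \<phi> \<sigma> x)"
    if \<sigma>: "\<sigma> \<in> T" and x: "x \<in> topspace (geometric_realization (Pow \<sigma>))" for x \<sigma>
  proof (cases "{v. x v \<noteq> 0} = \<sigma>")
    case True
    then show ?thesis using \<phi>_base[OF \<sigma> x] \<sigma> by (simp add: q_def p_def)
  next
    case False
    have "{v. x v \<noteq> 0} \<subseteq> \<sigma>"
      using x by (auto simp: topspace_geometric_simplex[OF T_face(2)[OF \<sigma>]])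
    then have "{v. x v \<noteq> 0} \<notin> T"
      using maximal[of "{v. x v \<noteq> 0}" \<sigma>] T_face(4)[OF \<sigma>] False by blast
    then show ?thesis using \<phi>_base[OF \<sigma> x] False by (simp add: q_def p_def)
  qed
  \<comment> \<open>A point mapped to the wedge point. For \<open>d = 0\<close> no critical facet
    supplies one.\<close>
  obtain a0 where a0: "a0 \<in> topspace A"
    using assms(1) unfolding contractible_complex_def by blast
  have None_W: "None \<in> topspace W"
  proof -
    have "(0, b) \<in> topspace (sum_topology (\<lambda>_. ?S) {..<?m})"
      using b_S assms(2) finite_T by (simp add: card_gt_0_iff)
    moreover have "p (0, b) = None" by (simp add: p_def)
    ultimately show ?thesis
      using p_quot unfolding quotient_map_def by (metis imageI)
  qed
  have closed_simplex: "closedin X (topspace (geometric_realization (Pow F)))" if "F \<in> K" for F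
  proof -
    have "finite F"
      using K that finite_V by (auto simp: complex_on_def intro: finite_subset)
    then have "compactin X (topspace (geometric_realization (Pow F)))"
      using compact_geometric_simplex subtopology_simplex[OF that]
      by (metis compact_space_def compactin_subtopology)
    then show ?thesis
      by (rule compactin_imp_closedin[OF Hausdorff_geometric_realization])
  qed
  \<comment> \<open>The closed simplices of the faces form a finite closed cover. A face outside
    \<open>T\<close> contains no member of \<open>T\<close>, so \<open>q\<close> is constant on
    it.\<close>
  have q_cont: "continuous_map X W q"
  proof (rule pasting_lemma_closed[OF complex_on_finite[OF K], where f = "\<lambda>_. q"
        and T = "\<lambda>F. topspace (geometric_realization (Pow F))"])
    fix F assume F: "F \<in> K"
    show "continuous_map (subtopology X (topspace (geometric_realization (Pow F)))) W q"
      unfolding subtopology_simplex[OF F]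
    proof (cases "F \<in> T")
      case True
      have "continuous_map ?S (sum_topology (\<lambda>_. ?S) {..<?m}) (\<lambda>s. (f F, s))"
        using f_lt[OF True] by (intro continuous_map_component_injection[where X = "\<lambda>_. ?S"]) simp
      then have "continuous_map (geometric_realization (Pow F)) W (p \<circ> ((\<lambda>s. (f F, s)) \<circ> \<phi> F))"
        using continuous_map_compose[OF \<phi>_cont[OF True]]
          continuous_map_compose[OF _ quotient_imp_continuous_map[OF p_quot]] by blast
      then show "continuous_map (geometric_realization (Pow F)) W q"
        by (rule continuous_map_eq) (simp add: q_simplex[OF True])
    next
      case False
      have q_None: "q x = None" if "x \<in> topspace (geometric_realization (Pow F))" for x
      proof -
        have "finite F"
          using K F finite_V by (auto simp: complex_on_def intro: finite_subset)
        then have "{v. x v \<noteq> 0} \<subseteq> F"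
          using that by (auto simp: topspace_geometric_simplex)
        then have "{v. x v \<noteq> 0} \<notin> T"
          using maximal[of "{v. x v \<noteq> 0}" F] F False by metis
        then show ?thesis by (simp add: q_def)
      qed
      have "continuous_map (geometric_realization (Pow F)) W (\<lambda>_. None)"
        by (simp add: None_W)
      then show "continuous_map (geometric_realization (Pow F)) W q"
        by (rule continuous_map_eq) (simp add: q_None)
    qed
  next
    fix x assume x: "x \<in> topspace X"
    then have "{v. x v \<noteq> 0} \<in> K" by (simp add: X_iff)
    with support_simplex[OF x]
    show "\<exists>F. F \<in> K \<and> x \<in> topspace (geometric_realization (Pow F)) \<and> q x = q x"
      by blast
  qed (use closed_simplex in simp_all)
  have q_closed: "closed_map X W q"
    unfolding closed_map_def
  proof (intro allI impI)
    fix C assume C: "closedin X C"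
    have "closedin (sum_topology (\<lambda>_. ?S) {..<?m})
      {z \<in> topspace (sum_topology (\<lambda>_. ?S) {..<?m}). p z \<in> q ` C}"
      unfolding closedin_sum_topology
    proof (intro conjI ballI)
      fix i assume i: "i \<in> {..<?m}"
      then obtain \<sigma> where \<sigma>: "\<sigma> \<in> T" "i = f \<sigma>"
        using f by (auto simp: bij_betw_def)
      let ?D = "topspace (geometric_realization (Pow \<sigma>))"
      \<comment> \<open>The base point is treated separately because the wedge point may also be hit
        from \<open>A\<close> or from the boundary of another facet.\<close>
      have "{s. (i, s) \<in> {z \<in> topspace (sum_topology (\<lambda>_. ?S) {..<?m}). p z \<in> q ` C}}
          = \<phi> \<sigma> ` (C \<inter> ?D) \<union> (if None \<in> q ` C then {b} else {})" (is "?l = ?r")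
      proof (intro equalityI subsetI)
        fix s assume "s \<in> ?l"
        then obtain x where s: "s \<in> topspace ?S" and x: "x \<in> C" "p (i, s) = q x"
          by auto
        show "s \<in> ?r"
        proof (cases "s = b")
          case True
          then have "q x = None" using x by (simp add: p_def)
          then have "None \<in> q ` C" using x(1) by force
          then show ?thesis using True by simp
        next
          case False
          let ?F = "{v. x v \<noteq> 0}"
          have F: "?F \<in> T" "f ?F = f \<sigma>" "\<phi> ?F x = s"
            using x(2) False \<sigma> by (auto simp: p_def q_def Let_def split: if_splits)
          then have "?F = \<sigma>"
            using f \<sigma>(1) by (auto simp: bij_betw_def dest: inj_onD)
          moreover have "x \<in> topspace X"
            using C x(1) closedin_subset by blast
          ultimately show ?thesis
            using support_simplex[of x] F x(1) by auto
        qed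
      next
        fix s assume "s \<in> ?r"
        then consider x where "x \<in> C" "x \<in> ?D" "s = \<phi> \<sigma> x" | "s = b" "None \<in> q ` C"
          by (auto split: if_splits)
        then show "s \<in> ?l"
        proof cases
          case 1
          moreover have "\<phi> \<sigma> x \<in> topspace ?S"
            using \<phi>_cont[OF \<sigma>(1)] 1(2) continuous_map_image_subset_topspace by blast
          moreover have "p (i, \<phi> \<sigma> x) \<in> q ` C"
            unfolding \<sigma>(2) q_simplex[OF \<sigma>(1) 1(2), symmetric] using 1(1) by (rule imageI)
          ultimately show ?thesis using i by simp
        next
          case 2
          moreover have "p (i, b) = None" by (simp add: p_def)
          ultimately show ?thesis using i b_S by simp
        qed
      qed
      moreover have "closedin ?S (\<phi> \<sigma> ` (C \<inter> ?D))"
      proof -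
        have "closed_map (geometric_realization (Pow \<sigma>)) ?S (\<phi> \<sigma>)"
          by (rule T1_Spaces.continuous_imp_closed_map[OF \<phi>_cont[OF \<sigma>(1)]
                compact_geometric_simplex[OF T_face(2)[OF \<sigma>(1)]] T1])
        moreover have "closedin (geometric_realization (Pow \<sigma>)) (C \<inter> ?D)"
          using C subtopology_simplex[OF T_face(4)[OF \<sigma>(1)]] by (metis closedin_subtopology)
        ultimately show ?thesis by (simp add: closed_map_def)
      qed
      moreover have "closedin ?S (if None \<in> q ` C then {b} else {})"
        using T1 b_S by (simp add: closedin_Hausdorff_sing_eq)
      ultimately show "closedin ?S {s. (i, s) \<in> {z \<in> topspace (sum_topology (\<lambda>_. ?S) {..<?m}). p z \<in> q ` C}}"
        by (simp only: closedin_Un)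
    qed auto
    moreover have "q ` C \<subseteq> topspace W"
      using continuous_map_image_subset_topspace[OF q_cont] closedin_subset[OF C] by blast
    ultimately show "closedin W (q ` C)"
      using p_quot unfolding quotient_map_closedin by blast
  qed
  have q_surj: "q ` topspace X = topspace W"
  proof
    show "q ` topspace X \<subseteq> topspace W"
      using continuous_map_image_subset_topspace[OF q_cont] .
    show "topspace W \<subseteq> q ` topspace X"
    proof
      fix w assume "w \<in> topspace W"
      then have "w \<in> p ` topspace (sum_topology (\<lambda>_. ?S) {..<?m})"
        using p_quot by (simp add: quotient_map_def)
      then obtain i s where w: "w = p (i, s)" "i < ?m" "s \<in> topspace ?S"
        by auto
      show "w \<in> q ` topspace X"
      proof (cases "s = b")
        case True
        then have "w = q a0" using w q_A[OF a0] by (simp add: p_def)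
        then show ?thesis using A_subset_X[OF a0] by blast
      next
        case False
        obtain \<sigma> where \<sigma>: "\<sigma> \<in> T" "i = f \<sigma>"
          using f w(2) by (auto simp: bij_betw_def)
        obtain x where x: "x \<in> topspace (geometric_realization (Pow \<sigma>))" "\<phi> \<sigma> x = s"
          using \<phi>_onto[OF \<sigma>(1) w(3) False] by blast
        have "x \<in> topspace X"
          using closedin_subset[OF closed_simplex[OF T_face(4)[OF \<sigma>(1)]]] x(1) by blast
        moreover have "q x = w"
          using q_simplex[OF \<sigma>(1) x(1)] x(2) w(1) \<sigma>(2) by simp
        ultimately show ?thesis by blast
      qed
    qed
  qed
  have q_quot: "quotient_map X W q"
    by (rule continuous_closed_imp_quotient_map[OF q_cont q_closed q_surj])
  \<comment> \<open>A value other than \<open>None\<close> reveals the facet through the injective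
    numbering \<open>f\<close>, and the point through injectivity of \<open>\<phi>\<close> away from
    \<open>b\<close>.\<close>
  have q_eq: "x = y \<or> x \<in> topspace A \<and> y \<in> topspace A"
    if x: "x \<in> topspace X" and y: "y \<in> topspace X" and eq: "q x = q y" for x y
  proof (cases "{v. x v \<noteq> 0} \<in> T")
    case True
    let ?F = "{v. x v \<noteq> 0}" and ?G = "{v. y v \<noteq> 0}"
    have G: "?G \<in> T" "f ?F = f ?G" "\<phi> ?F x = \<phi> ?G y"
      using eq True by (auto simp: q_def Let_def split: if_splits)
    then have FG: "?G = ?F"
      using f True by (auto simp: bij_betw_def dest: inj_onD)
    have "x = y"
    proof (rule \<phi>_inj[OF True])
      show "x \<in> topspace (geometric_realization (Pow ?F))" by (rule support_simplex[OF x])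
      then show "\<phi> ?F x \<noteq> b" using \<phi>_base[OF True] by blast
      show "y \<in> topspace (geometric_realization (Pow ?F))"
        using support_simplex[OF y] unfolding FG .
      show "\<phi> ?F x = \<phi> ?F y" using G(3) unfolding FG .
    qed
    then show ?thesis ..
  next
    case False
    then have "{v. y v \<noteq> 0} \<notin> T"
      using eq by (auto simp: q_def Let_def split: if_splits)
    with False show ?thesis using x y by (simp add: X_iff A_iff)
  qed
  have "contractible_space A"
    using assms(1) by (simp add: contractible_complex_def)
  then obtain H a where H: "continuous_map (prod_topology (top_of_set {0..1::real}) X) X H"
    "\<And>x. x \<in> topspace X \<Longrightarrow> H (0, x) = x"
    "\<And>s x. \<lbrakk>s \<in> {0..1}; x \<in> topspace A\<rbrakk> \<Longrightarrow> H (s, x) \<in> topspace A"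
    "\<And>x. x \<in> topspace A \<Longrightarrow> H (1, x) = a"
    by (rule extend_contraction) blast
  show ?thesis
    unfolding W_def[symmetric]
  proof (rule quotient_map_homotopy_equivalent[OF q_quot H(1,2)])
    fix s :: real and x y assume s: "s \<in> {0..1}" and xy: "x \<in> topspace X" "y \<in> topspace X" "q x = q y"
    from q_eq[OF xy] show "q (H (s, x)) = q (H (s, y))"
      using H(3)[OF s] q_A by metis
  next
    fix x y assume "x \<in> topspace X" "y \<in> topspace X" "q x = q y"
    from q_eq[OF this] show "H (1, x) = H (1, y)"
      using H(4) by metis
  qed
qed

end

section \<open>Simplicial vertices of chordal graphs\<close>

definition simplicial_vertex :: "'a set \<Rightarrow> ('a \<times> 'a) set \<Rightarrow> 'a \<Rightarrow> bool" where
  "simplicial_vertex V E s \<longleftrightarrow> s \<in> V \<and>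
     (\<forall>a\<in>V. \<forall>b\<in>V. (s, a) \<in> E \<longrightarrow> (s, b) \<in> E \<longrightarrow> a \<noteq> b \<longrightarrow> (a, b) \<in> E)"

lemma chordal_subset: "chordal V E \<Longrightarrow> W \<subseteq> V \<Longrightarrow> chordal W E"
  unfolding chordal_def induced_cycle_def by blast

lemma walk_of_rtrancl:
  assumes "(c, d) \<in> (E \<inter> W \<times> W)\<^sup>*" "c \<in> W"
  shows "\<exists>p. p \<noteq> [] \<and> hd p = c \<and> last p = d \<and> successively (\<lambda>u v. (u, v) \<in> E) p \<and> set p \<subseteq> W"
  using assms
proof (induction rule: rtrancl_induct)
  case base
  then show ?case by (intro exI[of _ "[c]"]) simp
next
  case (step d e)
  then obtain p where "p \<noteq> []" "hd p = c" "last p = d" "successively (\<lambda>u v. (u, v) \<in> E) p" "set p \<subseteq> W"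
    by blast
  with step show ?case
    by (intro exI[of _ "p @ [e]"]) (auto simp: successively_append_iff)
qed

text \<open>A repeated vertex or a chord would allow the segment between positions \<open>i\<close>
  and \<open>j\<close> to be cut out, leaving a shorter walk.\<close>

lemma shortest_walk_induced:
  fixes R :: "'a \<Rightarrow> 'a \<Rightarrow> bool" and a b S
  defines "walk \<equiv> \<lambda>p. p \<noteq> [] \<and> hd p = a \<and> last p = b \<and> successively R p \<and> set p \<subseteq> S"
  assumes p: "walk p" and min: "\<And>q. walk q \<Longrightarrow> length p \<le> length q"
    and ij: "i < j" "j < length p"
  shows "p ! i \<noteq> p ! j" "R (p ! i) (p ! j) \<Longrightarrow> j = Suc i"
proof -
  have tk: "successively R (take m p)" "successively R (drop m p)" for m
    using p append_take_drop_id[of m p] successively_append_iff[of R "take m p" "drop m p"]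
    by (auto simp: walk_def)
  have sub: "set (take l p @ drop m p) \<subseteq> S" for l m
    using p set_take_subset[of l p] set_drop_subset[of m p] by (auto simp: walk_def)
  have last: "last (take l p @ drop j p) = b" for l
    using p ij by (simp add: walk_def last_append last_drop)
  have hd_drop: "hd (drop j p) = p ! j"
    using ij by (simp add: hd_drop_conv_nth)
  show "p ! i \<noteq> p ! j"
  proof
    assume eq: "p ! i = p ! j"
    have "walk (take i p @ drop j p)"
    \<comment> \<open>For \<open>i = 0\<close> nothing precedes the cut, and the shortened walk
      starts at \<open>p ! j = a\<close>.\<close>
    proof (cases i)
      case 0
      then have "hd (drop j p) = a"
        using p eq hd_drop by (auto simp: walk_def hd_conv_nth)
      then show ?thesis
        unfolding walk_def using ij last[of i] sub[of i j] tk 0 by simp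
    next
      case (Suc l)
      have "last (take i p) = p ! l"
        using ij Suc by (simp add: take_Suc_conv_app_nth)
      moreover have "R (p ! l) (p ! i)"
        using p ij Suc by (simp add: walk_def successively_conv_nth)
      moreover have "hd (take i p @ drop j p) = a"
        using p Suc ij by (cases p) (auto simp: walk_def)
      ultimately show ?thesis
        unfolding walk_def using ij last[of i] sub[of i j] tk eq hd_drop
        by (simp add: successively_append_iff)
    qed
    from min[OF this] show False using ij by simp
  qed
  show "j = Suc i" if adj: "R (p ! i) (p ! j)"
  proof -
    have "last (take (Suc i) p) = p ! i"
      using ij by (simp add: take_Suc_conv_app_nth)
    moreover have "hd (take (Suc i) p @ drop j p) = a"
      using p ij by (cases p) (auto simp: walk_def)
    ultimately have "walk (take (Suc i) p @ drop j p)"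
      unfolding walk_def using ij last[of "Suc i"] sub[of "Suc i" j] tk adj hd_drop
      by (simp add: successively_append_iff)
    from min[OF this] show ?thesis using ij by simp
  qed
qed

text \<open>Otherwise \<open>x\<close> closes a shortest walk from \<open>a\<close> to
  \<open>b\<close> through \<open>W\<close> to an induced cycle: the walk has no chords, and
  \<open>x\<close> sees only its two ends. As \<open>a\<close> and \<open>b\<close> are not
  adjacent, the walk has at least three vertices and the cycle at least four.\<close>

lemma chordal_neighbours_adjacent:
  assumes "sym E" "irrefl E" "chordal V E"
    and "x \<in> V" "a \<in> V" "b \<in> V" "(x, a) \<in> E" "(x, b) \<in> E" "a \<noteq> b"
    and W: "W \<subseteq> V" "x \<notin> W" "\<And>w. w \<in> W \<Longrightarrow> (x, w) \<notin> E"
    and c: "(a, c) \<in> E" "(b, d) \<in> E" "c \<in> W" "d \<in> W" "(c, d) \<in> (E \<inter> W \<times> W)\<^sup>*"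
  shows "(a, b) \<in> E"
proof (rule ccontr)
  assume nab: "(a, b) \<notin> E"
  note symE = symD[OF \<open>sym E\<close>]
  have irr: "(z, z) \<notin> E" for z
    using \<open>irrefl E\<close> by (auto simp: irrefl_def)
  let ?R = "\<lambda>u v. (u, v) \<in> E"
  define walk where "walk = (\<lambda>p. p \<noteq> [] \<and> hd p = a \<and> last p = b \<and> successively ?R p \<and> set p \<subseteq> W \<union> {a, b})"
  obtain p0 where p0: "p0 \<noteq> []" "hd p0 = c" "last p0 = d" "successively ?R p0" "set p0 \<subseteq> W"
    using walk_of_rtrancl[OF c(5,3)] by blast
  have "successively ?R ([a] @ p0 @ [b])"
    unfolding successively_append_iff using p0 c symE[OF c(2)] by simp
  then have "walk (a # p0 @ [b])"
    using p0 by (auto simp: walk_def)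
  then obtain p where p: "walk p" and min: "\<And>q. walk q \<Longrightarrow> length p \<le> length q"
    using ex_has_least_nat[of walk _ length] by blast
  note ind = shortest_walk_induced[OF p[unfolded walk_def] min[unfolded walk_def]]
  have p_hd: "p ! 0 = a" and p_last: "p ! (length p - 1) = b" and p_ne: "p \<noteq> []"
    using p by (auto simp: walk_def hd_conv_nth last_conv_nth)
  have adj: "?R (p ! i) (p ! Suc i)" if "Suc i < length p" for i
    using p that by (simp add: walk_def successively_conv_nth)
  have len: "length p \<ge> 3"
  proof (rule ccontr)
    assume "\<not> length p \<ge> 3"
    moreover have "length p \<noteq> 0" "length p \<noteq> 1" "length p \<noteq> 2"
      using p_ne p_hd p_last \<open>a \<noteq> b\<close> nab adj[of 0] by (auto simp: numeral_2_eq_2)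
    ultimately show False by linarith
  qed
  have dist: "p ! i \<noteq> p ! j" if "i < length p" "j < length p" "i \<noteq> j" for i j
    using that ind(1)[of i j] ind(1)[of j i] by (cases "i < j") auto
  have adj_iff: "?R (p ! i) (p ! j) \<longleftrightarrow> j = Suc i \<or> i = Suc j" if "i < length p" "j < length p" for i j
    using that ind(2)[of i j] ind(2)[of j i] adj[of i] adj[of j] irr symE
    by (metis linorder_neqE_nat)
  have x_iff: "?R x (p ! i) \<longleftrightarrow> i = 0 \<or> Suc i = length p" if i: "i < length p" for i
  proof (cases "i = 0 \<or> Suc i = length p")
    case True
    then show ?thesis
      using p_hd p_last assms(7,8) by (metis diff_Suc_1)
  next
    case False
    have "0 < length p" "length p - 1 < length p" "i \<noteq> 0" "i \<noteq> length p - 1"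
      using i False by auto
    then have "p ! i \<noteq> a" "p ! i \<noteq> b"
      using dist[of i 0] dist[of i "length p - 1"] i p_hd p_last by auto
    moreover have "p ! i \<in> W \<union> {a, b}"
      using p nth_mem[OF i] unfolding walk_def by blast
    ultimately show ?thesis
      using W False by blast
  qed
  have p_V: "set p \<subseteq> V - {x}"
    using p W assms(5-8) irr by (auto simp: walk_def)
  have mod: "Suc k mod length (x # p) = (if k = length p then 0 else Suc k)" if "k < length (x # p)" for k
    using that by auto
  have "induced_cycle V E (x # p)"
    unfolding induced_cycle_def
  proof (intro conjI allI impI)
    show "distinct (x # p)"
      using p_V dist by (auto simp: distinct_conv_nth[of p])
    fix i j assume ij: "i < length (x # p)" "j < length (x # p)"
    show "((x # p) ! i, (x # p) ! j) \<in> E \<longleftrightarrow>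
        j = Suc i mod length (x # p) \<or> i = Suc j mod length (x # p)"
      unfolding mod[OF ij(1)] mod[OF ij(2)]
    proof (cases i; cases j)
      fix i' assume "i = Suc i'" "j = 0"
      then show "((x # p) ! i, (x # p) ! j) \<in> E \<longleftrightarrow>
        j = (if i = length p then 0 else Suc i) \<or> i = (if j = length p then 0 else Suc j)"
        using ij x_iff[of i'] symE len by auto
    next
      fix j' assume "i = 0" "j = Suc j'"
      then show "((x # p) ! i, (x # p) ! j) \<in> E \<longleftrightarrow>
        j = (if i = length p then 0 else Suc i) \<or> i = (if j = length p then 0 else Suc j)"
        using ij x_iff[of j'] len by auto
    next
      fix i' j' assume eq: "i = Suc i'" "j = Suc j'"
      then have b: "i' < length p" "j' < length p" using ij by simp_all
      show "((x # p) ! i, (x # p) ! j) \<in> E \<longleftrightarrow>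
        j = (if i = length p then 0 else Suc i) \<or> i = (if j = length p then 0 else Suc j)"
        using b by (simp only: eq nth_Cons_Suc adj_iff[OF b]) auto
    qed (use irr len in auto)
  qed (use p_V len \<open>x \<in> V\<close> in auto)
  then show False
    using \<open>chordal V E\<close> len by (force simp: chordal_def)
qed

text \<open>Dirac's theorem in a form strong enough for induction. A mere simplicial vertex of a
  smaller graph might lie in the separator that cuts it off and have further neighbours outside; the
  first conjunct allows it to be chosen away from a prescribed vertex.\<close>

lemma chordal_simplicial_vertices:
  assumes "sym E" "irrefl E" "finite V" "chordal V E"
  shows "(\<forall>x\<in>V. \<forall>y\<in>V. y \<noteq> x \<longrightarrow> (x, y) \<notin> E \<longrightarrow>
            (\<exists>s. simplicial_vertex V E s \<and> s \<noteq> x \<and> (x, s) \<notin> E)) \<and>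
         (V \<noteq> {} \<longrightarrow> (\<exists>s. simplicial_vertex V E s))"
  using assms(3,4)
proof (induction "card V" arbitrary: V rule: less_induct)
  case less
  note symE = symD[OF \<open>sym E\<close>]
  have irr: "(z, z) \<notin> E" for z
    using \<open>irrefl E\<close> by (auto simp: irrefl_def)
  have IH: "(\<forall>x\<in>U. \<forall>y\<in>U. y \<noteq> x \<longrightarrow> (x, y) \<notin> E \<longrightarrow>
            (\<exists>s. simplicial_vertex U E s \<and> s \<noteq> x \<and> (x, s) \<notin> E)) \<and>
         (U \<noteq> {} \<longrightarrow> (\<exists>s. simplicial_vertex U E s))" if "U \<subset> V" for U
    using that less.hyps[of U] less.prems chordal_subset
    by (meson finite_subset psubset_card_mono psubset_imp_subset)
  have 1: "\<exists>s. simplicial_vertex V E s \<and> s \<noteq> x \<and> (x, s) \<notin> E"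
    if x: "x \<in> V" and y: "y \<in> V" "y \<noteq> x" "(x, y) \<notin> E" for x y
  proof -
    define W where "W = {w \<in> V. w \<noteq> x \<and> (x, w) \<notin> E}"
    \<comment> \<open>\<open>C\<close> is the component of \<open>y\<close> among the non-neighbours
      of \<open>x\<close>, and \<open>A\<close> is the set of neighbours of \<open>x\<close> that
      touch it, so that \<open>A\<close> separates \<open>C\<close> from \<open>x\<close>.\<close>
    define C where "C = {z. (y, z) \<in> (E \<inter> W \<times> W)\<^sup>*}"
    define A where "A = {a \<in> V. (x, a) \<in> E \<and> (\<exists>c\<in>C. (a, c) \<in> E)}"
    have yW: "y \<in> W" using y by (simp add: W_def)
    have yC: "y \<in> C" by (simp add: C_def)
    have CW: "C \<subseteq> W"
    proof
      fix z assume "z \<in> C"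
      then have "(y, z) \<in> (E \<inter> W \<times> W)\<^sup>*" by (simp add: C_def)
      then show "z \<in> W" by (induction rule: rtrancl_induct) (use yW in auto)
    qed
    have symR: "sym ((E \<inter> W \<times> W)\<^sup>*)"
      using \<open>sym E\<close> by (intro sym_rtrancl) (auto simp: sym_def)
    \<comment> \<open>Two vertices of \<open>A\<close> are neighbours of \<open>x\<close> joined by
      a walk through \<open>C\<close>, on which \<open>x\<close> has no neighbours.\<close>
    have clique: "(a, b) \<in> E" if ab: "a \<in> A" "b \<in> A" "a \<noteq> b" for a b
    proof -
      obtain c d where cd: "c \<in> C" "(a, c) \<in> E" "d \<in> C" "(b, d) \<in> E"
        using ab by (auto simp: A_def)
      have path: "(c, d) \<in> (E \<inter> W \<times> W)\<^sup>*"
        using cd symD[OF symR] by (auto simp: C_def intro: rtrancl_trans)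
      have "a \<in> V" "b \<in> V" "(x, a) \<in> E" "(x, b) \<in> E" "c \<in> W" "d \<in> W"
        using ab cd CW by (auto simp: A_def)
      moreover have "W \<subseteq> V" "x \<notin> W" "\<And>w. w \<in> W \<Longrightarrow> (x, w) \<notin> E"
        by (auto simp: W_def)
      ultimately show ?thesis
        using cd ab path by (intro chordal_neighbours_adjacent[OF assms(1,2) less.prems(2) x, of a b W c d])
    qed
    have nbr: "w \<in> C \<union> A" if "c \<in> C" "w \<in> V" "(c, w) \<in> E" for c w
    proof (cases "(x, w) \<in> E")
      case True
      then show ?thesis using that symE by (auto simp: A_def)
    next
      case False
      have "c \<in> W" using that CW by blast
      then have "w \<noteq> x" using that symE by (auto simp: W_def)
      then have "(c, w) \<in> E \<inter> W \<times> W"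
        using that False \<open>c \<in> W\<close> by (auto simp: W_def)
      with \<open>c \<in> C\<close> show ?thesis
        by (auto simp: C_def intro: rtrancl_into_rtrancl)
    qed
    have CAV: "C \<union> A \<subseteq> V - {x}"
      using CW irr by (auto simp: A_def W_def)
    \<comment> \<open>All neighbours of a vertex of \<open>C\<close> lie in
      \<open>C \<union> A\<close>, so simpliciality there is simpliciality in
      \<open>V\<close>.\<close>
    have lift: "simplicial_vertex V E s \<and> s \<noteq> x \<and> (x, s) \<notin> E"
      if "simplicial_vertex (C \<union> A) E s" "s \<in> C" for s
    proof -
      have "s \<in> W" using that CW by blast
      then show ?thesis
        using that nbr[of s] unfolding simplicial_vertex_def W_def by blast
    qed
    \<comment> \<open>It remains to find a simplicial vertex of \<open>C \<union> A\<close> inside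
      \<open>C\<close>. If some \<open>a\<close> in \<open>A\<close> has a non-neighbour there,
      induction gives one not adjacent to \<open>a\<close>, which lies outside the clique
      \<open>A\<close>. Otherwise every vertex of \<open>A\<close> is adjacent to all others, and
      any simplicial vertex of \<open>C\<close> will do.\<close>
    show ?thesis
    proof (cases "\<exists>a\<in>A. \<exists>z\<in>C \<union> A. z \<noteq> a \<and> (a, z) \<notin> E")
      case True
      then obtain a z where "a \<in> A" "z \<in> C \<union> A" "z \<noteq> a" "(a, z) \<notin> E"
        by blast
      then obtain s where s: "simplicial_vertex (C \<union> A) E s" "s \<noteq> a" "(a, s) \<notin> E"
        using IH[of "C \<union> A"] CAV x by blast
      then have "s \<in> C"
        using clique[of a s] \<open>a \<in> A\<close> by (auto simp: simplicial_vertex_def)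
      with s lift show ?thesis by blast
    next
      case False
      obtain s where s: "simplicial_vertex C E s"
        using IH[of C] CAV x yC by blast
      have "simplicial_vertex (C \<union> A) E s"
        unfolding simplicial_vertex_def
      proof (intro conjI ballI impI)
        show "s \<in> C \<union> A" using s by (simp add: simplicial_vertex_def)
        fix a b assume ab: "a \<in> C \<union> A" "b \<in> C \<union> A" "(s, a) \<in> E" "(s, b) \<in> E" "a \<noteq> b"
        consider "a \<in> A" | "b \<in> A" | "a \<in> C" "b \<in> C" using ab by blast
        then show "(a, b) \<in> E"
        proof cases
          case 1
          then show ?thesis using False ab by metis
        next
          case 2
          then have "(b, a) \<in> E" using False ab by metis
          then show ?thesis by (rule symE)
        next
          case 3
          then show ?thesis using s ab(3-) unfolding simplicial_vertex_def by blast
        qed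
      qed
      moreover have "s \<in> C" using s by (simp add: simplicial_vertex_def)
      ultimately show ?thesis using lift by blast
    qed
  qed
  have 2: "\<exists>s. simplicial_vertex V E s" if ne: "V \<noteq> {}"
  proof -
    obtain y where y: "y \<in> V" using ne by blast
    show ?thesis
    proof (cases "\<exists>z\<in>V. z \<noteq> y \<and> (y, z) \<notin> E")
      case True
      then show ?thesis using 1 y by blast
    next
      \<comment> \<open>Here \<open>y\<close> is adjacent to every other vertex, so putting it back
        preserves simplicial vertices.\<close>
      case dom: False
      show ?thesis
      proof (cases "V = {y}")
        case True
        then show ?thesis by (auto simp: simplicial_vertex_def)
      next
        case False
        then obtain s where "simplicial_vertex (V - {y}) E s"
          using IH[of "V - {y}"] y by blast
        then have s: "s \<in> V" "\<And>a b. \<lbrakk>a \<in> V - {y}; b \<in> V - {y}; (s, a) \<in> E; (s, b) \<in> E; a \<noteq> b\<rbrakk> \<Longrightarrow> (a, b) \<in> E"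
          by (auto simp: simplicial_vertex_def)
        have "simplicial_vertex V E s"
          unfolding simplicial_vertex_def
        proof (intro conjI ballI impI)
          fix a b assume ab: "a \<in> V" "b \<in> V" "(s, a) \<in> E" "(s, b) \<in> E" "a \<noteq> b"
          show "(a, b) \<in> E"
            by (cases "a = y"; cases "b = y") (use ab s(2)[of a b] dom symE in auto)
        qed (fact s(1))
        then show ?thesis by blast
      qed
    qed
  qed
  show ?case using 1 2 by blast
qed

section \<open>Total cut complexes of chordal graphs\<close>

lemma components_eq_iff:
  assumes "sym E"
  shows "E\<^sup>* `` {x} = E\<^sup>* `` {y} \<longleftrightarrow> (x, y) \<in> E\<^sup>*"
proof -
  have "equiv UNIV (E\<^sup>*)"
    using assms by (simp add: equiv_def refl_rtrancl sym_rtrancl trans_rtrancl)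
  then show ?thesis
    by (simp add: eq_equiv_class_iff)
qed

lemma connected_components_eq_image: "connected_components U E = (\<lambda>x. E\<^sup>* `` {x}) ` U"
  by (auto simp: connected_components_def quotient_def)

lemma card_connected_components_delete_isolated:
  assumes "finite_simple_graph V E" "v \<in> V" "\<And>u. (v, u) \<notin> E"
  shows "card (connected_components V E) = Suc (card (connected_components (V - {v}) E))"
proof -
  let ?f = "\<lambda>x. E\<^sup>* `` {x}"
  have "sym E" "finite V" using assms by (auto simp: finite_simple_graph_def)
  have iso: "x = v" if "(v, x) \<in> E\<^sup>*" for x
    using that assms(3) by (auto elim: converse_rtranclE)
  have "?f v \<notin> ?f ` (V - {v})"
    using iso components_eq_iff[OF \<open>sym E\<close>, of v] by fastforce
  moreover have "?f ` V = insert (?f v) (?f ` (V - {v}))"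
    using \<open>v \<in> V\<close> by blast
  ultimately show ?thesis
    using \<open>finite V\<close> by (simp add: connected_components_eq_image)
qed

text \<open>The neighbours of \<open>v\<close> form a clique, so walks through \<open>v\<close> can
  be rerouted through \<open>u\<close>. The components of the smaller graph are therefore those of
  the larger one with \<open>v\<close> removed, and none becomes empty.\<close>

lemma card_connected_components_delete_simplicial:
  assumes G: "finite_simple_graph V E" and v: "simplicial_vertex V E v" and u: "(v, u) \<in> E"
  shows "card (connected_components V E)
    = card (connected_components (V - {v}) (E \<inter> (V - {v}) \<times> (V - {v})))"
proof -
  let ?E' = "E \<inter> (V - {v}) \<times> (V - {v})"
  let ?f = "\<lambda>x. E\<^sup>* `` {x}" and ?g = "\<lambda>x. ?E'\<^sup>* `` {x}"
  have "sym E" "irrefl E" and EV: "E \<subseteq> V \<times> V"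
    using G by (auto simp: finite_simple_graph_def)
  note symE = symD[OF \<open>sym E\<close>]
  have symE': "sym ?E'" using \<open>sym E\<close> by (auto simp: sym_def)
  have uv: "u \<in> V" "u \<noteq> v" "v \<in> V"
    using u EV \<open>irrefl E\<close> by (auto simp: irrefl_def)
  have nbr: "(u, w) \<in> ?E'\<^sup>*" if w: "(v, w) \<in> E" for w
  proof (cases "w = u")
    case False
    have "w \<in> V" "w \<noteq> v" using w EV \<open>irrefl E\<close> by (auto simp: irrefl_def)
    moreover have "(u, w) \<in> E"
      using v u w uv False \<open>w \<in> V\<close> unfolding simplicial_vertex_def by metis
    ultimately show ?thesis using uv by blast
  qed simp
  \<comment> \<open>sending v to its neighbour u retracts walks of the graph to walks avoiding v\<close>
  define r where "r = (\<lambda>x. if x = v then u else x)"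
  have step: "(r x, r y) \<in> ?E'\<^sup>*" if xy: "(x, y) \<in> E" for x y
  proof -
    consider "x = v" "y \<noteq> v" | "y = v" "x \<noteq> v" | "x \<noteq> v" "y \<noteq> v"
      using xy \<open>irrefl E\<close> by (auto simp: irrefl_def)
    then show ?thesis
    proof cases
      case 1
      then show ?thesis using nbr xy by (simp add: r_def)
    next
      case 2
      then have "(u, x) \<in> ?E'\<^sup>*" using nbr symE[OF xy] by simp
      then show ?thesis using 2 symD[OF sym_rtrancl[OF symE']] by (simp add: r_def)
    next
      case 3
      then have "(x, y) \<in> ?E'" using xy EV by blast
      then show ?thesis using 3 by (simp add: r_def r_into_rtrancl)
    qed
  qed
  have retract: "(r x, r y) \<in> ?E'\<^sup>*" if "(x, y) \<in> E\<^sup>*" for x y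
    using that
  proof (induction rule: rtrancl_induct)
    case (step y z)
    then show ?case using \<open>\<And>x y. (x, y) \<in> E \<Longrightarrow> (r x, r y) \<in> ?E'\<^sup>*\<close> by (blast intro: rtrancl_trans)
  qed simp
  have iff: "(x, y) \<in> E\<^sup>* \<longleftrightarrow> (x, y) \<in> ?E'\<^sup>*" if "x \<in> V - {v}" "y \<in> V - {v}" for x y
    using retract[of x y] that rtrancl_mono[of ?E' E] by (auto simp: r_def)
  have "?f v = ?f u"
    using components_eq_iff[OF \<open>sym E\<close>] u by blast
  moreover have "?f u \<in> ?f ` (V - {v})"
    using uv by blast
  moreover have "?f ` V = insert (?f v) (?f ` (V - {v}))"
    using uv by blast
  ultimately have "?f ` V = ?f ` (V - {v})"
    by (simp add: insert_absorb)
  moreover have g_eq: "?g x = ?f x - {v}" if x: "x \<in> V - {v}" for x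
  proof -
    have in_V: "y \<in> V" if "(x, y) \<in> E\<^sup>*" for y
      using that by (induction rule: rtrancl_induct) (use x EV in auto)
    have in_W: "y \<in> V - {v}" if "(x, y) \<in> ?E'\<^sup>*" for y
      using that by (induction rule: rtrancl_induct) (use x in auto)
    show ?thesis
    proof (intro equalityI subsetI)
      fix y assume "y \<in> ?g x"
      then show "y \<in> ?f x - {v}" using in_W[of y] iff[OF x, of y] by simp
    next
      fix y assume "y \<in> ?f x - {v}"
      then show "y \<in> ?g x" using in_V[of y] iff[OF x, of y] by simp
    qed
  qed
  \<comment> \<open>Both classes have a representative other than \<open>v\<close>, so they still
    meet after \<open>v\<close> is removed and must coincide.\<close>
  moreover have "inj_on (\<lambda>C. C - {v}) (?f ` (V - {v}))"
  proof (rule inj_onI)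
    fix C D assume "C \<in> ?f ` (V - {v})" "D \<in> ?f ` (V - {v})" and eq: "C - {v} = D - {v}"
    then obtain x y where xy: "y \<noteq> v" and CD: "C = ?f x" "D = ?f y" by blast
    have "y \<in> D - {v}" using CD xy by simp
    then have "(x, y) \<in> E\<^sup>*" unfolding eq[symmetric] using CD by simp
    then show "C = D" unfolding CD components_eq_iff[OF \<open>sym E\<close>] .
  qed
  moreover have "?g ` (V - {v}) = (\<lambda>C. C - {v}) ` (?f ` (V - {v}))"
    unfolding image_image by (rule image_cong) (simp_all add: g_eq)
  ultimately show ?thesis
    by (simp only: connected_components_eq_image card_image)
qed

section \<open>Links and deletions in total cut complexes\<close>

lemma finite_simple_graph_induced:
  "finite_simple_graph V E \<Longrightarrow> finite_simple_graph (V - {v}) (E \<inter> (V - {v}) \<times> (V - {v}))"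
  by (auto simp: finite_simple_graph_def sym_def irrefl_def)

lemma induced_cycle_cong:
  assumes "W \<subseteq> V" "induced_cycle W (E \<inter> W \<times> W) p"
  shows "induced_cycle V E p"
proof -
  have "p ! i \<in> W" if "i < length p" for i
    using assms(2) that nth_mem by (fastforce simp: induced_cycle_def)
  then show ?thesis
    using assms by (auto simp: induced_cycle_def)
qed

lemma chordal_induced:
  "chordal V E \<Longrightarrow> W \<subseteq> V \<Longrightarrow> chordal W (E \<inter> W \<times> W)"
  unfolding chordal_def using induced_cycle_cong by blast

text \<open>The induction hypothesis speaks of an induced subgraph with restricted edges, while
  links and deletions are expressed with the original \<open>E\<close>.\<close>

lemma total_cut_complex_restrict:
  "total_cut_complex W (E \<inter> W \<times> W) k = total_cut_complex W E k"
proof -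
  have "independent_set W (E \<inter> W \<times> W) S \<longleftrightarrow> independent_set W E S" for S
    by (auto simp: independent_set_def)
  then show ?thesis by (simp add: total_cut_complex_def)
qed

lemma complex_on_total_cut_complex:
  "finite V \<Longrightarrow> complex_on V (total_cut_complex V E k)"
  by (auto simp: complex_on_def total_cut_complex_def)

text \<open>The bound makes every face attaining it a facet, which later provides the maximality of
  the members of \<open>T\<close>.\<close>

lemma card_total_cut_complex_face:
  assumes "finite V" "F \<in> total_cut_complex V E k"
  shows "card F + k \<le> card V"
proof -
  obtain S where "S \<subseteq> V" "card S = k" "F \<subseteq> V - S"
    using assms(2) by (auto simp: total_cut_complex_def independent_set_def)
  then show ?thesis
    using assms(1) card_mono[of "V - S" F] card_mono[of V S]
    by (simp add: card_Diff_subset finite_subset)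
qed

lemma insert_in_total_cut_complex_iff:
  assumes "v \<in> V" "v \<notin> F"
  shows "insert v F \<in> total_cut_complex V E k \<longleftrightarrow> F \<in> total_cut_complex (V - {v}) E k"
proof -
  have "independent_set V E S \<and> card S = k \<and> insert v F \<subseteq> V - S \<longleftrightarrow>
      independent_set (V - {v}) E S \<and> card S = k \<and> F \<subseteq> V - {v} - S" for S
    using assms unfolding independent_set_def by blast
  then show ?thesis by (simp add: total_cut_complex_def)
qed

lemma total_cut_complex_split:
  assumes "v \<in> V"
  shows "total_cut_complex V E k = {F \<in> total_cut_complex V E k. v \<notin> F}
    \<union> insert v ` total_cut_complex (V - {v}) E k"
    (is "?K = ?D \<union> insert v ` ?L")
proof (intro equalityI subsetI)
  fix F assume F: "F \<in> ?K"
  show "F \<in> ?D \<union> insert v ` ?L"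
  proof (cases "v \<in> F")
    case True
    then have "F = insert v (F - {v})" by blast
    moreover have "F - {v} \<in> ?L"
      using insert_in_total_cut_complex_iff[OF assms, of "F - {v}" E k] F True by (simp add: insert_absorb)
    ultimately show ?thesis by blast
  qed (use F in simp)
next
  fix F assume "F \<in> ?D \<union> insert v ` ?L"
  moreover have "insert v F \<in> ?K" if "F \<in> ?L" for F
    using that insert_in_total_cut_complex_iff[OF assms, of F E k]
    by (auto simp: total_cut_complex_def)
  ultimately show "F \<in> ?K" by blast
qed

text \<open>An isolated \<open>v\<close> can be added to any independent set of the smaller graph.
  Conversely, one vertex is dropped from an independent set: \<open>v\<close> if it occurs there,
  and any other one if not.\<close>

lemma total_cut_complex_deletion_isolated:
  assumes "finite V" "v \<in> V" "sym E" "\<And>u. (v, u) \<notin> E"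
  shows "{F \<in> total_cut_complex V E (Suc k). v \<notin> F} = total_cut_complex (V - {v}) E k"
proof (intro equalityI subsetI)
  fix F assume "F \<in> {F \<in> total_cut_complex V E (Suc k). v \<notin> F}"
  then obtain S where S: "independent_set V E S" "card S = Suc k" "F \<subseteq> V - S" "v \<notin> F"
    by (auto simp: total_cut_complex_def)
  then have "finite S" by (intro card_ge_0_finite) simp
  obtain s where s: "s \<in> S" "v \<in> S \<longrightarrow> s = v"
    using S(2) by (metis card.empty ex_in_conv nat.distinct(1))
  have "independent_set (V - {v}) E (S - {s})" "card (S - {s}) = k" "F \<subseteq> V - {v} - (S - {s})"
    using S s \<open>finite S\<close> by (auto simp: independent_set_def)
  then show "F \<in> total_cut_complex (V - {v}) E k"
    unfolding total_cut_complex_def by blast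
next
  fix F assume "F \<in> total_cut_complex (V - {v}) E k"
  then obtain S where S: "independent_set (V - {v}) E S" "card S = k" "F \<subseteq> V - {v} - S"
    by (auto simp: total_cut_complex_def)
  then have "finite S" "v \<notin> S"
    using assms(1) by (auto simp: independent_set_def intro: finite_subset)
  then have "independent_set V E (insert v S)" "card (insert v S) = Suc k" "F \<subseteq> V - insert v S" "v \<notin> F"
    using S assms by (auto simp: independent_set_def dest: symD)
  then show "F \<in> {F \<in> total_cut_complex V E (Suc k). v \<notin> F}"
    unfolding total_cut_complex_def by blast
qed

lemma total_cut_complex_deletion_cone:
  assumes "finite V" "sym E" "irrefl E" and v: "simplicial_vertex V E v" and u: "u \<in> V" "(v, u) \<in> E"
    and F: "F \<in> total_cut_complex V E k" "v \<notin> F"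
  shows "insert u F \<in> total_cut_complex V E k"
proof -
  obtain S where S: "independent_set V E S" "card S = k" "F \<subseteq> V - S"
    using F by (auto simp: total_cut_complex_def)
  show ?thesis
  proof (cases "u \<in> S")
    case False
    then show ?thesis using S u by (auto simp: total_cut_complex_def)
  next
    case True
    \<comment> \<open>exchange u for v: another neighbour of v in S would be adjacent to u\<close>
    let ?S = "insert v (S - {u})"
    have nadj: "(v, w) \<notin> E" if "w \<in> S - {u}" for w
    proof
      assume "(v, w) \<in> E"
      then have "(u, w) \<in> E"
        using that S v u unfolding simplicial_vertex_def independent_set_def by blast
      then show False
        using that True S by (auto simp: independent_set_def)
    qed
    have "v \<notin> S" using S u True by (auto simp: independent_set_def)
    have "finite S" using S assms(1) by (auto simp: independent_set_def intro: finite_subset)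
    have "?S \<subseteq> V"
      using S(1) v by (auto simp: independent_set_def simplicial_vertex_def)
    moreover have "(a, b) \<notin> E" if ab: "a \<in> ?S" "b \<in> ?S" for a b
    proof (cases "a = v \<or> b = v")
      case True
      then show ?thesis
        using ab nadj symD[OF assms(2)] irreflD[OF \<open>irrefl E\<close>] by (metis insertE)
    next
      case False
      then show ?thesis using ab S(1) by (simp add: independent_set_def)
    qed
    ultimately have "independent_set V E ?S"
      by (simp add: independent_set_def)
    moreover have "card ?S = k"
      using \<open>finite S\<close> \<open>v \<notin> S\<close> card_Suc_Diff1[OF \<open>finite S\<close> True] S by simp
    moreover have "insert u F \<subseteq> V - ?S"
      using S F u \<open>irrefl E\<close> by (auto simp: irrefl_def)
    ultimately show ?thesis
      unfolding total_cut_complex_def by blast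
  qed
qed

section \<open>Critical facets and their number\<close>

text \<open>Number of spheres for c components; unlike the binomial coefficient of the theorem it also covers
  k = 0 (where the complex is a full simplex) and the graph without vertices.\<close>

fun sphere_count :: "nat \<Rightarrow> nat \<Rightarrow> nat" where
  "sphere_count 0 0 = 1"
| "sphere_count 0 (Suc k) = 0"
| "sphere_count (Suc c) 0 = 0"
| "sphere_count (Suc c) (Suc k) = sphere_count c k + sphere_count c (Suc k)"

text \<open>\<open>sphere_count c k\<close> is c - 1 choose k - 1 with the convention that -1 choose
  -1 is 1, and the last equation of its definition is Pascal's rule.\<close>

lemma sphere_count_eq: "sphere_count (Suc c) (Suc k) = c choose k"
proof (induction c arbitrary: k)
  case 0
  then show ?case by (cases k) auto
next
  case (Suc c)
  then show ?case by (cases k) auto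
qed

text \<open>T is the set of facets that survive as spheres once the collapsible remainder is contracted.\<close>

lemma total_cut_complex_critical_facets:
  assumes "finite_simple_graph V E" "chordal V E"
  shows "\<exists>T\<subseteq>total_cut_complex V E k. (\<forall>F\<in>T. card F + k = card V) \<and>
    card T = sphere_count (card (connected_components V E)) k \<and>
    collapsible (total_cut_complex V E k - T)"
  using assms
proof (induction "card V" arbitrary: V E k rule: less_induct)
  case less
  note G = less.prems(1)
  have fin: "finite V" "sym E" "irrefl E" "E \<subseteq> V \<times> V"
    using G by (auto simp: finite_simple_graph_def)
  have fin_conn: "finite (connected_components V E)"
    using fin(1) by (simp add: connected_components_def quotient_def)
  show ?case
  proof (cases "V = {}")
    case True
    then have conn: "connected_components V E = {}"
      by (simp add: connected_components_def quotient_def)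
    show ?thesis
    proof (cases k)
      case 0
      \<comment> \<open>The single face has no partner to collapse with, so it is itself critical
        and the remainder is void.\<close>
      have "total_cut_complex V E k = {{}}"
        using True 0 by (auto simp: total_cut_complex_def independent_set_def)
      then show ?thesis
        using True 0 conn by (intro exI[of _ "{{}}"]) (simp add: collapsible.void)
    next
      case (Suc l)
      have "total_cut_complex V E k = {}"
        using True Suc by (auto simp: total_cut_complex_def independent_set_def)
      then show ?thesis
        using conn Suc by (intro exI[of _ "{}"]) (simp add: collapsible.void)
    qed
  next
    case False
    show ?thesis
    proof (cases k)
      case 0
      obtain u where u: "u \<in> V" using False by blast
      have full: "total_cut_complex V E k = Pow V"
        using 0 fin(1) by (auto simp: total_cut_complex_def independent_set_def
            intro: exI[of _ "{}"] dest: finite_subset)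
      \<comment> \<open>A full simplex on a nonempty set is a cone over any of its vertices, in
        accordance with the count 0 for \<open>k = 0\<close>.\<close>
      have "collapsible (Pow V)"
        by (rule collapsible_cone[where u = u]) (use u fin(1) finite_subset in auto)
      moreover have "connected_components V E \<noteq> {}"
        using False by (auto simp: connected_components_def quotient_def)
      then obtain c where "card (connected_components V E) = Suc c"
        using fin_conn by (metis card_eq_0_iff not0_implies_Suc)
      ultimately show ?thesis
        using 0 full by (intro exI[of _ "{}"]) simp
    next
      case (Suc l)
      obtain v where v: "simplicial_vertex V E v"
        using conjunct2[OF chordal_simplicial_vertices[OF fin(2,3,1) less.prems(2)]] False by auto
      then have vV: "v \<in> V" by (simp add: simplicial_vertex_def)
      let ?W = "V - {v}"
      let ?E' = "E \<inter> ?W \<times> ?W"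
      let ?D = "{F \<in> total_cut_complex V E k. v \<notin> F}"
      let ?L = "total_cut_complex ?W E k"
      have cardW: "Suc (card ?W) = card V"
        using vV fin(1) by (metis card_Suc_Diff1)
      \<comment> \<open>Stated for every \<open>j\<close>, since an isolated \<open>v\<close>
        requires both \<open>k\<close> for the link and \<open>l\<close> for the deletion.\<close>
      have IH: "\<exists>T\<subseteq>total_cut_complex ?W E j. (\<forall>F\<in>T. card F + j = card ?W) \<and>
          card T = sphere_count (card (connected_components ?W ?E')) j \<and>
          collapsible (total_cut_complex ?W E j - T)" for j
        using less.hyps[of ?W ?E' j] finite_simple_graph_induced[OF G] chordal_induced[OF less.prems(2)]
          cardW by (auto simp: total_cut_complex_restrict)
      have vL: "v \<notin> F" if "F \<in> total_cut_complex ?W E j" for F j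
        using that by (auto simp: total_cut_complex_def)
      obtain TL where TL: "TL \<subseteq> ?L" "\<forall>F\<in>TL. card F + k = card ?W"
        "card TL = sphere_count (card (connected_components ?W ?E')) k" "collapsible (?L - TL)"
        using IH[of k] by blast
      have inj: "inj_on (insert v) ?L"
        using vL by (intro inj_onI) (metis insert_ident)
      have finL: "finite F" if "F \<in> total_cut_complex ?W E j" for F j
        using that fin(1) by (auto simp: total_cut_complex_def intro: finite_subset)
      have fin_tcc: "finite (total_cut_complex U E j)" if "U \<subseteq> V" for U j
        using complex_on_finite[OF complex_on_total_cut_complex] that fin(1) finite_subset by metis
      have cardTL: "card (insert v ` TL) = card TL"
        using inj TL(1) by (intro card_image) (rule inj_on_subset)
      have facet_TL: "card F + k = card V" if "F \<in> insert v ` TL" for F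
        using that TL(1,2) vL finL cardW by (force simp: card_insert_if)
      have img_diff: "insert v ` ?L - insert v ` TL = insert v ` (?L - TL)"
        using inj_on_image_set_diff[OF inj, of ?L TL] TL(1) by simp
      have split: "total_cut_complex V E k = ?D \<union> insert v ` ?L"
        by (rule total_cut_complex_split[OF vV])
      show ?thesis
      proof (cases "\<exists>u. (v, u) \<in> E")
        case True
        then obtain u where u: "(v, u) \<in> E" "u \<in> V" "u \<noteq> v"
          using fin by (auto simp: irrefl_def)
        \<comment> \<open>The deletion is a cone and contributes no critical facet; all of them come
          from the link with \<open>v\<close> added, and the number of components is
          unchanged.\<close>
        have "collapsible ?D"
        proof (rule collapsible_cone[where u = u])
          fix F assume F: "F \<in> ?D"
          then have "insert u F \<in> total_cut_complex V E k"
            using total_cut_complex_deletion_cone[OF fin(1-3) v u(2,1)] by blast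
          moreover have "F - {u} \<in> total_cut_complex V E k"
            using F complex_on_total_cut_complex[OF fin(1)] by (auto simp: complex_on_def)
          ultimately show "insert u F \<in> ?D \<and> F - {u} \<in> ?D"
            using F u by auto
          show "finite F"
            using F fin(1) by (auto simp: total_cut_complex_def intro: finite_subset)
        qed (use fin_tcc[of V] in simp)
        then have "collapsible (?D \<union> insert v ` (?L - TL))"
          using TL(4) vL by (intro collapsible_attach_cone) auto
        moreover have "total_cut_complex V E k - insert v ` TL = ?D \<union> insert v ` (?L - TL)"
          unfolding img_diff[symmetric] by (subst split) auto
        moreover have "insert v ` TL \<subseteq> total_cut_complex V E k"
          using TL(1) split by blast
        moreover have "card (insert v ` TL) = sphere_count (card (connected_components V E)) k"
          unfolding cardTL TL(3) card_connected_components_delete_simplicial[OF G v u(1)] ..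
        ultimately show ?thesis
          using facet_TL by (intro exI[of _ "insert v ` TL"]) simp
      next
        case iso: False
        have E': "?E' = E"
          using fin iso symD[OF fin(2)] by blast
        have D: "?D = total_cut_complex ?W E l"
          using total_cut_complex_deletion_isolated[OF fin(1) vV fin(2)] iso Suc by simp
        obtain TD where TD: "TD \<subseteq> ?D" "\<forall>F\<in>TD. card F + l = card ?W"
          "card TD = sphere_count (card (connected_components ?W E)) l" "collapsible (?D - TD)"
          using IH[of l] unfolding D E' by blast
        \<comment> \<open>Both sides contribute. One component disappears with \<open>v\<close>, so
          the two counts add up by the recursion of \<open>sphere_count\<close>. Facets of the
          deletion have the right size because \<open>k\<close> and the number of vertices both drop
          by one.\<close>
        have "collapsible ((?D - TD) \<union> insert v ` (?L - TL))"
          using TL(4) TD(4) vL D by (intro collapsible_attach_cone) auto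
        moreover have "total_cut_complex V E k - (TD \<union> insert v ` TL) = (?D - TD) \<union> insert v ` (?L - TL)"
          unfolding img_diff[symmetric] using TD(1) TL(1) by (subst split) auto
        moreover have "card (TD \<union> insert v ` TL) = card TD + card TL"
        proof -
          have "finite TD" "finite TL"
            using TD(1) TL(1) fin_tcc[of V k] fin_tcc[of ?W k] by (auto intro: finite_subset)
          moreover have "TD \<inter> insert v ` TL = {}" using TD(1) by auto
          ultimately show ?thesis by (simp add: card_Un_disjoint cardTL)
        qed
        moreover have "card (connected_components V E) = Suc (card (connected_components ?W E))"
          using card_connected_components_delete_isolated[OF G vV] iso by blast
        moreover have "card F + k = card V" if "F \<in> TD" for F
          using TD(2) that cardW Suc by auto
        moreover have "TD \<union> insert v ` TL \<subseteq> total_cut_complex V E k"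
          using TD(1) TL(1) split by blast
        ultimately show ?thesis
          using TD(3) TL(3) facet_TL unfolding E' Suc
          by (intro exI[of _ "TD \<union> insert v ` TL"]) auto
      qed
    qed
  qed
qed

lemma max_card_face_maximal:
  assumes "complex_on V K" "\<And>\<rho>. \<rho> \<in> K \<Longrightarrow> card \<rho> \<le> card \<sigma>" "\<rho> \<in> K" "\<sigma> \<subseteq> \<rho>"
  shows "\<rho> = \<sigma>"
proof -
  have "finite \<rho>"
    using assms(1,3) by (auto simp: complex_on_def intro: finite_subset)
  then show ?thesis
    using assms(2)[OF assms(3)] assms(4) card_seteq by blast
qed

lemma homotopy_equivalent_empty_wedge:
  assumes "d < 0"
  shows "geometric_realization {{}} homotopy_equivalent_space wedge_of_spheres m d"
proof -
  have "x \<notin> topspace (geometric_realization {{}})" for x :: "'a \<Rightarrow> real"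
    by (auto simp: geometric_realization_def)
  then have "topspace (geometric_realization {{}} :: ('a \<Rightarrow> real) topology) = {}"
    by blast
  moreover have "topspace (wedge_of_spheres m d) = {}"
    using assms by (simp add: wedge_of_spheres_def wedge_def topspace_quotient_topology unit_sphere_def)
  ultimately show ?thesis
    by (intro homeomorphic_imp_homotopy_equivalent_space) (simp add: homeomorphic_empty_space_eq)
qed

theorem theorem4p13:
  fixes V :: "'a set" and E :: "('a \<times> 'a) set" and n c k :: nat
  assumes "finite_simple_graph V E"
    and "chordal V E"
    and "n = card V"
    and "c = card (connected_components V E)"
    and "k \<ge> 1"
  shows "(c \<ge> k \<longrightarrow>
            total_cut_complex V E k \<noteq> {} \<and>
            geometric_realization (total_cut_complex V E k) homotopy_equivalent_space
              wedge_of_spheres ((c - 1) choose (k - 1)) (int n - int k - 1)) \<and>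
         (c < k \<longrightarrow>
            ((\<exists>S. independent_set V E S \<and> card S = k) \<longrightarrow>
               contractible_complex (total_cut_complex V E k)) \<and>
            ((\<nexists>S. independent_set V E S \<and> card S = k) \<longrightarrow>
               total_cut_complex V E k = {}))"
proof (intro conjI impI)
  let ?K = "total_cut_complex V E k"
  have fin: "finite V"
    using assms(1) by (simp add: finite_simple_graph_def)
  have K: "complex_on V ?K"
    by (rule complex_on_total_cut_complex[OF fin])
  obtain l where l: "k = Suc l"
    using \<open>k \<ge> 1\<close> by (metis Suc_le_D One_nat_def)
  obtain T where T: "T \<subseteq> ?K" "\<And>F. F \<in> T \<Longrightarrow> card F + k = n" "card T = sphere_count c k"
    "collapsible (?K - T)"
    using total_cut_complex_critical_facets[OF assms(1,2), of k] unfolding assms(3,4) by blast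
  have finT: "finite T"
    using T(1) complex_on_finite[OF K] by (rule finite_subset)
  have card_le: "card F + k \<le> n" if "F \<in> ?K" for F
    unfolding assms(3) by (rule card_total_cut_complex_face[OF fin that])
  {
    assume "c \<ge> k"
    then obtain c' where c': "c = Suc c'" "l \<le> c'"
      using l by (metis Suc_le_D Suc_le_mono)
    have cardT: "card T = (c - 1) choose (k - 1)"
      unfolding T(3) c'(1) l by (simp only: sphere_count_eq diff_Suc_1)
    moreover have "(c - 1) choose (k - 1) > 0"
      using c' l by simp
    ultimately have Tne: "T \<noteq> {}" by auto
    then show Kne: "?K \<noteq> {}"
      using T(1) by blast
    obtain F0 where F0: "F0 \<in> T" using Tne by blast
    have "{} \<in> ?K"
      using T(1) F0 K by (auto simp: complex_on_def)
    show "geometric_realization ?K homotopy_equivalent_space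
        wedge_of_spheres ((c - 1) choose (k - 1)) (int n - int k - 1)"
    proof (cases "n = k")
      \<comment> \<open>Faces have at most n - k = 0 vertices, so the complex consists of the empty
        face alone and both spaces are empty.\<close>
      case True
      have "F = {}" if "F \<in> ?K" for F
      proof -
        have "F \<subseteq> V" using K that by (auto simp: complex_on_def)
        then have "finite F" using fin by (rule finite_subset)
        then show ?thesis using card_le[OF that] True by simp
      qed
      then have "?K = {{}}" using \<open>{} \<in> ?K\<close> by blast
      then show ?thesis
        using True by (simp add: homotopy_equivalent_empty_wedge)
    next
      case False
      define d where "d = n - k - 1"
      have n: "n = Suc d + k"
        using False T(2)[OF F0] by (simp add: d_def)
      \<comment> \<open>Members of \<open>T\<close> attain the largest possible face size n - k,
        which yields maximality.\<close>
      interpret critical_facets V ?K T d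
      proof
        fix \<sigma> \<rho> assume \<sigma>: "\<sigma> \<in> T"
        show "card \<sigma> = Suc d" using T(2)[OF \<sigma>] n by simp
        show "\<rho> = \<sigma>" if "\<rho> \<in> ?K" "\<sigma> \<subseteq> \<rho>"
        proof (rule max_card_face_maximal[OF K _ that])
          show "card \<rho>' \<le> card \<sigma>" if "\<rho>' \<in> ?K" for \<rho>'
            using card_le[OF that] T(2)[OF \<sigma>] by simp
        qed
      qed (use K T(1) in auto)
      \<comment> \<open>Critical facets have \<open>Suc d\<close> vertices, so the remainder keeps
        the empty face; being collapsible and nonvoid, it is contractible.\<close>
      have "{} \<in> ?K - T"
        using \<open>{} \<in> ?K\<close> card_T[of "{}"] by auto
      then have "contractible_complex (?K - T)"
        by (intro collapsible_imp_contractible[OF T(4) complex_A]) blast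
      moreover have "int n - int k - 1 = int d"
        using n by simp
      ultimately show ?thesis
        using homotopy_equivalent_wedge Tne unfolding cardT[symmetric] by simp
    qed
  }
  {
    assume "c < k"
    \<comment> \<open>With fewer components than \<open>k\<close> there are no critical facets, so
      the complex itself is collapsible. The case \<open>c = 0\<close> is the graph without
      vertices.\<close>
    have "sphere_count c k = 0"
      using \<open>c < k\<close> by (cases c) (simp_all add: l sphere_count_eq del: sphere_count.simps(4))
    then have "T = {}" using T(3) finT by simp
    assume "\<exists>S. independent_set V E S \<and> card S = k"
    then have "?K \<noteq> {}"
      unfolding total_cut_complex_def by blast
    then show "contractible_complex ?K"
      using collapsible_imp_contractible[OF _ K] T(4) \<open>T = {}\<close> by simp
  }
  show "?K = {}" if "\<nexists>S. independent_set V E S \<and> card S = k"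
    using that unfolding total_cut_complex_def by blast
qed

end
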